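(* Let $\Sigma^2$ be an oriented $2$-manifold, let $f:\Sigma^2\to\mathbb R^3$ be a front in the Euclidean $3$-space, and let $p\in\Sigma^2$ be a swallowtail singularity of $f$, with unit normal $\nu$ and singular curve $\gamma$, $\gamma(0)=p$. Let $P$ be the tangential plane of $f$ at $f(p)$, that is, the plane passing through $f(p)$ orthogonal to $\nu(p)$, and let $\sigma$ be the orthogonal projection of $\hat\gamma:=f\circ\gamma$ to the plane $P$. Then the limiting singular curvature $\tau_s$ of $f$ at $p$ coincides with the absolute value of the cuspidal curvature of the curve $\sigma$ in the plane $P$.
   Context: All maps are $C^\infty$. A singular point of $f$ is a point where $f$ is not an immersion. $f$ is a frontal if around each point there is a unit vector field $\nu$ along $f$ orthogonal to $df(a)$ for all tangent vectors $a$; it is a front if moreover $(f,\nu)$ is an immersion. A unit normal $\nu$ is fixed near $p$. A singular point $p$ is a swallowtail if the map germ of $f$ at $p$ is right-left equivalent (equivalent under diffeomorphism germs of source and target) to $(u,v)\mapsto(u,4v^3+2uv,3v^4+uv^2)$ at the origin. Near a swallowtail the singular set is a regular curve $\gamma(u)$ in $\Sigma^2$ with $\gamma(0)=p$ (the singular curve), $\hat\gamma'(0)=0$, and for $u\neq0$ small $\hat\gamma'(u)\ne0$. Singular curvature: at $\gamma(u)$ with $u\neq0$, $|\kappa_s|=|\det(\hat\gamma',\hat\gamma'',\nu(\gamma))|/|\hat\gamma'|^3$ (only its absolute value is needed). Limiting singular curvature: $\tau_s:=2\sqrt2\,\lim_{t\to0}\sqrt{|t|}\,|\kappa_s(\gamma(t))|$,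 where $t$ is the (signed) arclength parameter of $\hat\gamma$ measured from $p$. Cuspidal curvature of a plane curve $\sigma$ with a $3/2$-cusp at $0$ (that is, $\sigma'(0)=0$ and $\det(\sigma''(0),\sigma'''(0))\neq0$): $\det(\sigma''(0),\sigma'''(0))/|\sigma''(0)|^{5/2}$. *)

theory Defs
  imports "HOL-Analysis.Analysis"
begin

text \<open>Smoothness of maps between Euclidean spaces; these notions are meant for open sets \<open>S\<close>.
  All iterated directional derivatives being continuous is the same as being \<open>C\<^sup>\<infinity>\<close>.\<close>

primrec Ck_on :: "nat \<Rightarrow> 'a::euclidean_space set \<Rightarrow> ('a \<Rightarrow> 'b::euclidean_space) \<Rightarrow> bool" where
  "Ck_on 0 S f \<longleftrightarrow> continuous_on S f"
| "Ck_on (Suc k) S f \<longleftrightarrow> (\<forall>x\<in>S. f differentiable at x) \<and>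
     (\<forall>v. Ck_on k S (\<lambda>x. frechet_derivative f (at x) v))"

definition smooth_on :: "'a::euclidean_space set \<Rightarrow> ('a \<Rightarrow> 'b::euclidean_space) \<Rightarrow> bool" where
  "smooth_on S f \<longleftrightarrow> (\<forall>k. Ck_on k S f)"

definition diffeo_on :: "'a::euclidean_space set \<Rightarrow> ('a \<Rightarrow> 'a) \<Rightarrow> bool" where
  "diffeo_on S f \<longleftrightarrow> open S \<and> open (f ` S) \<and> inj_on f S \<and>
     smooth_on S f \<and> smooth_on (f ` S) (inv_into S f)"


text \<open>An oriented smooth 2-manifold is a (Hausdorff, second countable) type together with an
  atlas of charts \<open>(U, \<phi>)\<close> whose transition maps are smooth with positive Jacobian.
  The atlas need not be maximal.\<close>

type_synonym 'a atlas = "('a set \<times> ('a \<Rightarrow> real^2)) set"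

definition oriented_atlas :: "'a::{t2_space,second_countable_topology} atlas \<Rightarrow> bool" where
  "oriented_atlas A \<longleftrightarrow>
     (\<Union>(U, \<phi>)\<in>A. U) = UNIV \<and>
     (\<forall>(U, \<phi>)\<in>A. open U \<and> open (\<phi> ` U) \<and> homeomorphism U (\<phi> ` U) \<phi> (inv_into U \<phi>)) \<and>
     (\<forall>(U, \<phi>)\<in>A. \<forall>(V, \<psi>)\<in>A.
        smooth_on (\<phi> ` (U \<inter> V)) (\<psi> \<circ> inv_into U \<phi>) \<and>
        (\<forall>x \<in> \<phi> ` (U \<inter> V).
           det (matrix (frechet_derivative (\<psi> \<circ> inv_into U \<phi>) (at x))) > 0))"

definition smooth_map_on ::
  "'a::topological_space atlas \<Rightarrow> 'a set \<Rightarrow> ('a \<Rightarrow> 'b::euclidean_space) \<Rightarrow> bool" where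
  "smooth_map_on A W f \<longleftrightarrow> open W \<and>
     (\<forall>(U, \<phi>)\<in>A. smooth_on (\<phi> ` (U \<inter> W)) (f \<circ> inv_into U \<phi>))"

text \<open>The differential at \<open>a\<close>, read in the chart \<open>(U, \<phi>)\<close>: tangent vectors at \<open>a\<close> are represented
  by their coordinates in \<open>real^2\<close>.\<close>

definition chart_diff ::
  "'a set \<times> ('a \<Rightarrow> real^2) \<Rightarrow> ('a \<Rightarrow> 'b::euclidean_space) \<Rightarrow> 'a \<Rightarrow> real^2 \<Rightarrow> 'b" where
  "chart_diff c f a = (case c of (U, \<phi>) \<Rightarrow> frechet_derivative (f \<circ> inv_into U \<phi>) (at (\<phi> a)))"

definition immersive_at ::
  "'a::topological_space atlas \<Rightarrow> ('a \<Rightarrow> 'b::euclidean_space) \<Rightarrow> 'a \<Rightarrow> bool" where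
  "immersive_at A f a \<longleftrightarrow> (\<forall>c\<in>A. a \<in> fst c \<longrightarrow> inj (chart_diff c f a))"

definition singular_pt ::
  "'a::topological_space atlas \<Rightarrow> ('a \<Rightarrow> real^3) \<Rightarrow> 'a \<Rightarrow> bool" where
  "singular_pt A f a \<longleftrightarrow> \<not> immersive_at A f a"

text \<open>A diffeomorphism from the open subset \<open>W\<close> of the manifold onto an open subset of the
  plane (not necessarily compatible with the orientation).\<close>

definition smooth_coords_on ::
  "'a::topological_space atlas \<Rightarrow> 'a set \<Rightarrow> ('a \<Rightarrow> real^2) \<Rightarrow> bool" where
  "smooth_coords_on A W k \<longleftrightarrow>
     open (k ` W) \<and> homeomorphism W (k ` W) k (inv_into W k) \<and> smooth_map_on A W k \<and>
     (\<forall>(U, \<phi>)\<in>A. smooth_on (k ` (U \<inter> W)) (\<phi> \<circ> inv_into W k))"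

definition regular_curve ::
  "'a::topological_space atlas \<Rightarrow> real set \<Rightarrow> (real \<Rightarrow> 'a) \<Rightarrow> bool" where
  "regular_curve A I \<gamma> \<longleftrightarrow> open I \<and> is_interval I \<and> continuous_on I \<gamma> \<and>
     (\<forall>(U, \<phi>)\<in>A. smooth_on (I \<inter> \<gamma> -` U) (\<phi> \<circ> \<gamma>) \<and>
        (\<forall>u \<in> I \<inter> \<gamma> -` U. vector_derivative (\<phi> \<circ> \<gamma>) (at u) \<noteq> 0))"


definition unit_normal_on ::
  "'a::topological_space atlas \<Rightarrow> ('a \<Rightarrow> real^3) \<Rightarrow> 'a set \<Rightarrow> ('a \<Rightarrow> real^3) \<Rightarrow> bool" where
  "unit_normal_on A f W \<nu> \<longleftrightarrow> smooth_map_on A W \<nu> \<and> (\<forall>a\<in>W. norm (\<nu> a) = 1) \<and>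
     (\<forall>a\<in>W. \<forall>c\<in>A. a \<in> fst c \<longrightarrow> (\<forall>v. \<nu> a \<bullet> chart_diff c f a v = 0))"

definition front :: "'a::topological_space atlas \<Rightarrow> ('a \<Rightarrow> real^3) \<Rightarrow> bool" where
  "front A f \<longleftrightarrow> smooth_map_on A UNIV f \<and>
     (\<forall>a. \<exists>W \<nu>. a \<in> W \<and> unit_normal_on A f W \<nu> \<and>
        (\<forall>b\<in>W. immersive_at A (\<lambda>x. (f x, \<nu> x)) b))"

definition std_swallowtail :: "real^2 \<Rightarrow> real^3" where
  "std_swallowtail x = (let u = x $ 1; v = x $ 2 in
     vector [u, 4 * v^3 + 2 * u * v, 3 * v^4 + u * v^2])"

text \<open>Right-left equivalence of the germ of \<open>f\<close> at \<open>p\<close> to the germ of the standard swallowtail at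
  the origin: \<open>f = \<Psi> \<circ> std_swallowtail \<circ> k\<close> near \<open>p\<close>.\<close>

definition swallowtail ::
  "'a::topological_space atlas \<Rightarrow> ('a \<Rightarrow> real^3) \<Rightarrow> 'a \<Rightarrow> bool" where
  "swallowtail A f p \<longleftrightarrow> singular_pt A f p \<and>
     (\<exists>W k E \<Psi>. p \<in> W \<and> smooth_coords_on A W k \<and> k p = 0 \<and>
        0 \<in> E \<and> diffeo_on E \<Psi> \<and>
        (\<forall>a\<in>W. std_swallowtail (k a) \<in> E \<and> f a = \<Psi> (std_swallowtail (k a))))"

text \<open>\<open>\<gamma>\<close> is a regular parametrization, on an open interval around \<open>0\<close>, of the singular set of
  \<open>f\<close> near \<open>p\<close>.\<close>

definition singular_curve ::
  "'a::topological_space atlas \<Rightarrow> ('a \<Rightarrow> real^3) \<Rightarrow> 'a \<Rightarrow> real set \<Rightarrow> (real \<Rightarrow> 'a) \<Rightarrow> bool" where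
  "singular_curve A f p I \<gamma> \<longleftrightarrow> regular_curve A I \<gamma> \<and> 0 \<in> I \<and> \<gamma> 0 = p \<and>
     (\<exists>W. open W \<and> p \<in> W \<and> \<gamma> ` I = {a \<in> W. singular_pt A f a})"


definition nth_deriv :: "nat \<Rightarrow> (real \<Rightarrow> 'a::real_normed_vector) \<Rightarrow> real \<Rightarrow> 'a" where
  "nth_deriv n c = ((\<lambda>d u. vector_derivative d (at u)) ^^ n) c"

text \<open>The absolute value of the singular curvature at \<open>\<gamma> u\<close>.\<close>

definition abs_sing_curv ::
  "('a \<Rightarrow> real^3) \<Rightarrow> ('a \<Rightarrow> real^3) \<Rightarrow> (real \<Rightarrow> 'a) \<Rightarrow> real \<Rightarrow> real" where
  "abs_sing_curv f \<nu> \<gamma> u =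
     \<bar>det (vector [nth_deriv 1 (f \<circ> \<gamma>) u, nth_deriv 2 (f \<circ> \<gamma>) u, \<nu> (\<gamma> u)] :: real^3^3)\<bar>
       / norm (nth_deriv 1 (f \<circ> \<gamma>) u) ^ 3"

text \<open>The integral is oriented, so this is the signed arclength measured from \<open>c 0\<close>.\<close>

definition arclength :: "(real \<Rightarrow> real^3) \<Rightarrow> real \<Rightarrow> real" where
  "arclength c u = (LBINT x=0..u. norm (nth_deriv 1 c x))"

text \<open>The function of the arclength parameter \<open>t\<close> whose limit at \<open>0\<close> is \<open>\<tau>\<^sub>s\<close>; the parameter value
  of \<open>\<gamma>\<close> at arclength \<open>t\<close> is unique for \<open>t\<close> close to \<open>0\<close> when \<open>f \<circ> \<gamma>\<close> is regular close to, but
  not at, \<open>0\<close>.\<close>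

definition scaled_sing_curv ::
  "('a \<Rightarrow> real^3) \<Rightarrow> ('a \<Rightarrow> real^3) \<Rightarrow> real set \<Rightarrow> (real \<Rightarrow> 'a) \<Rightarrow> real \<Rightarrow> real" where
  "scaled_sing_curv f \<nu> I \<gamma> t =
     sqrt \<bar>t\<bar> * abs_sing_curv f \<nu> \<gamma> (the_inv_into I (arclength (f \<circ> \<gamma>)) t)"

definition limiting_sing_curv ::
  "('a \<Rightarrow> real^3) \<Rightarrow> ('a \<Rightarrow> real^3) \<Rightarrow> real set \<Rightarrow> (real \<Rightarrow> 'a) \<Rightarrow> real" where
  "limiting_sing_curv f \<nu> I \<gamma> = 2 * sqrt 2 * Lim (at 0) (scaled_sing_curv f \<nu> I \<gamma>)"


definition cusp_det :: "(real \<Rightarrow> real^2) \<Rightarrow> real" where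
  "cusp_det c = det (vector [nth_deriv 2 c 0, nth_deriv 3 c 0] :: real^2^2)"

definition three_half_cusp :: "(real \<Rightarrow> real^2) \<Rightarrow> bool" where
  "three_half_cusp c \<longleftrightarrow> nth_deriv 1 c 0 = 0 \<and> cusp_det c \<noteq> 0"

definition cuspidal_curv :: "(real \<Rightarrow> real^2) \<Rightarrow> real" where
  "cuspidal_curv c = cusp_det c / norm (nth_deriv 2 c 0) powr (5/2)"


definition tangential_plane ::
  "('a \<Rightarrow> real^3) \<Rightarrow> ('a \<Rightarrow> real^3) \<Rightarrow> 'a \<Rightarrow> (real^3) set" where
  "tangential_plane f \<nu> p = {x. (x - f p) \<bullet> \<nu> p = 0}"

definition orth_proj :: "(real^3) set \<Rightarrow> real^3 \<Rightarrow> real^3" where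
  "orth_proj P x = (THE y. y \<in> P \<and> (\<forall>z\<in>P. (x - y) \<bullet> (z - y) = 0))"

text \<open>A cartesian coordinate system of the plane \<open>P\<close>: an origin and an orthonormal frame.\<close>

definition plane_frame :: "(real^3) set \<Rightarrow> real^3 \<Rightarrow> real^3 \<Rightarrow> real^3 \<Rightarrow> bool" where
  "plane_frame P q e1 e2 \<longleftrightarrow> q \<in> P \<and> q + e1 \<in> P \<and> q + e2 \<in> P \<and>
     norm e1 = 1 \<and> norm e2 = 1 \<and> e1 \<bullet> e2 = 0"

definition plane_coords :: "real^3 \<Rightarrow> real^3 \<Rightarrow> real^3 \<Rightarrow> real^3 \<Rightarrow> real^2" where
  "plane_coords q e1 e2 x = vector [(x - q) \<bullet> e1, (x - q) \<bullet> e2]"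

end

theory Submission
  imports Defs
begin

text \<open>
  In swallowtail coordinates the singular set is \<open>u = - 6 v\<^sup>2\<close>, so the singular curve is
  \<open>v = y\<close>, \<open>u = - 6 y\<^sup>2\<close> for a function \<open>y\<close> with \<open>y 0 = 0\<close> and \<open>y' 0 \<noteq> 0\<close>. The velocity of its
  image \<open>c\<close> factors as \<open>c' = m w\<close> with \<open>m = - 12 y y'\<close>, where \<open>w\<close> and \<open>w'\<close> are linearly independent
  and tangent to the limiting tangent plane at \<open>0\<close>. Then \<open>c' \<times> c'' = m\<^sup>2 (w \<times> w')\<close> exactly, and
  the signed arclength is asymptotic to \<open>\<bar>m' 0\<bar> \<bar>w 0\<bar> s \<bar>s\<bar> / 2\<close>, which gives the limit of the
  rescaled singular curvature. The projection of \<open>c\<close> to the tangent plane has a velocity of the same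
  form, so its second and third derivatives at \<open>0\<close> can be read off from \<open>m\<close> and \<open>w\<close>.\<close>

section \<open>Smooth maps\<close>

lemma Ck_on_subset: "Ck_on k S f \<Longrightarrow> T \<subseteq> S \<Longrightarrow> Ck_on k T f"
  by (induction k arbitrary: f) (auto intro: continuous_on_subset)

text \<open>Openness of \<open>S\<close> makes the derivatives of \<open>f\<close> and
  \<open>g\<close> agree at every point of \<open>S\<close>, so the equality of the functions is
  inherited by all their directional derivatives.\<close>

lemma Ck_on_cong:
  assumes "open S" "Ck_on k S f" "\<And>x. x \<in> S \<Longrightarrow> f x = g x"
  shows "Ck_on k S g"
  using assms(2,3)
proof (induction k arbitrary: f g)
  case 0
  then show ?case by (auto cong: continuous_on_cong)
next
  case (Suc k)
  have der: "(g has_derivative frechet_derivative f (at x)) (at x)" if "x \<in> S" for x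
  proof (rule has_derivative_transform_within_open[OF _ \<open>open S\<close> that])
    show "(f has_derivative frechet_derivative f (at x)) (at x)"
      using Suc.prems(1) that by (simp flip: frechet_derivative_works)
  qed (rule Suc.prems(2))
  have eq: "frechet_derivative f (at x) = frechet_derivative g (at x)" if "x \<in> S" for x
    using frechet_derivative_at[OF der[OF that]] .
  have "Ck_on k S (\<lambda>x. frechet_derivative g (at x) v)" for v
    by (rule Suc.IH[of "\<lambda>x. frechet_derivative f (at x) v"]) (use Suc.prems(1) eq in simp_all)
  then show ?case using der by (auto simp: differentiable_def)
qed

text \<open>The recursion asks for continuity only at its last level; at each earlier level
  continuity comes from differentiability.\<close>

lemma Ck_on_Suc_D: "Ck_on (Suc k) S f \<Longrightarrow> Ck_on k S f"
proof (induction k arbitrary: f)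
  case 0
  then show ?case
    by (auto intro!: continuous_at_imp_continuous_on differentiable_imp_continuous_within)
next
  case (Suc k)
  from Suc.prems have "\<forall>x\<in>S. f differentiable at x"
    and "\<And>v. Ck_on (Suc k) S (\<lambda>x. frechet_derivative f (at x) v)"
    by (simp_all only: Ck_on.simps) blast+
  with Suc.IH show ?case by simp
qed

lemma Ck_on_imp_continuous_on: "Ck_on k S f \<Longrightarrow> continuous_on S f"
  by (induction k) (simp, metis Ck_on_Suc_D)

text \<open>Trades the chosen \<open>frechet_derivative\<close> for an explicit formula
  \<open>f'\<close>, which is how the closure rules below run their inductions.\<close>

lemma Ck_on_SucI:
  assumes "open S" "\<And>x. x \<in> S \<Longrightarrow> (f has_derivative f' x) (at x)" "\<And>v. Ck_on k S (\<lambda>x. f' x v)"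
  shows "Ck_on (Suc k) S f"
proof -
  have "frechet_derivative f (at x) = f' x" if "x \<in> S" for x
    using frechet_derivative_at[OF assms(2)[OF that]] by simp
  then have "Ck_on k S (\<lambda>x. frechet_derivative f (at x) v)" for v
    by (intro Ck_on_cong[OF \<open>open S\<close> assms(3)[of v]]) simp
  then show ?thesis using assms(2) by (auto simp: differentiable_def)
qed

lemma Ck_on_Suc_derivative:
  assumes "Ck_on (Suc k) S f" "x \<in> S"
  shows "(f has_derivative frechet_derivative f (at x)) (at x)"
  using assms frechet_derivative_works by auto

lemma Ck_on_UN:
  assumes "\<And>i. i \<in> X \<Longrightarrow> open (S i)" "\<And>i. i \<in> X \<Longrightarrow> Ck_on k (S i) f"
  shows "Ck_on k (\<Union>i\<in>X. S i) f"
  using assms(2)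
proof (induction k arbitrary: f)
  case 0
  then show ?case using assms(1) by (auto intro!: continuous_on_open_UN)
qed auto

lemma Ck_on_const: "open S \<Longrightarrow> Ck_on k S (\<lambda>x. a)"
  by (induction k arbitrary: a) (auto simp: frechet_derivative_const)

lemma Ck_on_bounded_linear:
  assumes "open S" "bounded_linear L"
  shows "Ck_on k S L"
proof (cases k)
  case 0
  then show ?thesis using assms by (auto intro: bounded_linear.continuous_on continuous_on_id)
next
  case (Suc n)
  show ?thesis unfolding Suc
    by (rule Ck_on_SucI[where f' = "\<lambda>_. L"])
      (use assms in \<open>auto intro: bounded_linear_imp_has_derivative Ck_on_const\<close>)
qed

lemma Ck_on_add:
  assumes "open S" "Ck_on k S f" "Ck_on k S g"
  shows "Ck_on k S (\<lambda>x. f x + g x)"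
  using assms(2,3)
proof (induction k arbitrary: f g)
  case 0
  then show ?case by (auto intro: continuous_intros)
next
  case (Suc k)
  show ?case
  proof (rule Ck_on_SucI[OF \<open>open S\<close>])
    show "((\<lambda>x. f x + g x) has_derivative
      (\<lambda>v. frechet_derivative f (at x) v + frechet_derivative g (at x) v)) (at x)" if "x \<in> S" for x
      by (intro has_derivative_add Ck_on_Suc_derivative[OF Suc.prems(1) that]
        Ck_on_Suc_derivative[OF Suc.prems(2) that])
  qed (use Suc in simp)
qed

lemma Ck_on_sum:
  assumes "open S" "\<And>i. i \<in> X \<Longrightarrow> Ck_on k S (f i)"
  shows "Ck_on k S (\<lambda>x. \<Sum>i\<in>X. f i x)"
  using assms(2)
  by (induction X rule: infinite_finite_induct)
    (auto intro: Ck_on_const Ck_on_add assms(1))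

text \<open>The product rule yields two products of the same kind with one factor differentiated, so
  the induction needs \<open>f\<close> and \<open>g\<close> arbitrary. Scaling, multiplication and
  the inner product are all instances.\<close>

lemma Ck_on_bilinear:
  fixes f :: "'a::euclidean_space \<Rightarrow> 'b::euclidean_space" and g :: "'a \<Rightarrow> 'c::euclidean_space"
    and prod :: "'b \<Rightarrow> 'c \<Rightarrow> 'd::euclidean_space"
  assumes "bounded_bilinear prod" "open S" "Ck_on k S f" "Ck_on k S g"
  shows "Ck_on k S (\<lambda>x. prod (f x) (g x))"
  using assms(3,4)
proof (induction k arbitrary: f g)
  case 0
  then show ?case using assms(1) by (auto intro: bounded_bilinear.continuous_on)
next
  case (Suc k)
  show ?case
  proof (rule Ck_on_SucI[OF \<open>open S\<close>])
    show "((\<lambda>x. prod (f x) (g x)) has_derivative (\<lambda>v. prod (f x) (frechet_derivative g (at x) v) +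
        prod (frechet_derivative f (at x) v) (g x))) (at x)" if "x \<in> S" for x
      by (intro bounded_bilinear.FDERIV[OF assms(1)] Ck_on_Suc_derivative[OF Suc.prems(1) that]
        Ck_on_Suc_derivative[OF Suc.prems(2) that])
    show "Ck_on k S (\<lambda>x. prod (f x) (frechet_derivative g (at x) v) +
        prod (frechet_derivative f (at x) v) (g x))" for v
      using Suc.prems Suc.prems[THEN Ck_on_Suc_D]
      by (intro Ck_on_add[OF \<open>open S\<close>] Suc.IH) simp_all
  qed
qed

lemma Ck_on_compose:
  assumes "open S" "Ck_on k S f" "Ck_on k T g" "f ` S \<subseteq> T"
  shows "Ck_on k S (\<lambda>x. g (f x))"
  using assms(2-)
proof (induction k arbitrary: g)
  case 0
  then show ?case by (auto intro: continuous_on_compose2)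
next
  case (Suc k)
  have der: "(g has_derivative frechet_derivative g (at (f x))) (at (f x))" if "x \<in> S" for x
    by (rule Ck_on_Suc_derivative[OF Suc.prems(2)]) (use Suc.prems(3) that in auto)
  \<comment> \<open>Expanding in a basis separates the point from the direction in the chain rule.\<close>
  have eq: "(\<Sum>b\<in>Basis. (frechet_derivative f (at x) v \<bullet> b) *\<^sub>R frechet_derivative g (at (f x)) b)
      = frechet_derivative g (at (f x)) (frechet_derivative f (at x) v)" if "x \<in> S" for x v
  proof -
    interpret linear "frechet_derivative g (at (f x))"
      using der[OF that] by (rule has_derivative_linear)
    have "frechet_derivative g (at (f x)) (frechet_derivative f (at x) v) =
      frechet_derivative g (at (f x)) (\<Sum>b\<in>Basis. (frechet_derivative f (at x) v \<bullet> b) *\<^sub>R b)"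
      by (simp add: euclidean_representation)
    then show ?thesis by (simp add: sum scale)
  qed
  show ?case
  proof (rule Ck_on_SucI[OF \<open>open S\<close>])
    show "((\<lambda>x. g (f x)) has_derivative
      (\<lambda>v. frechet_derivative g (at (f x)) (frechet_derivative f (at x) v))) (at x)" if "x \<in> S" for x
      by (rule has_derivative_compose[OF Ck_on_Suc_derivative[OF Suc.prems(1) that] der[OF that]])
    show "Ck_on k S (\<lambda>x. frechet_derivative g (at (f x)) (frechet_derivative f (at x) v))" for v
    proof (rule Ck_on_cong[OF \<open>open S\<close> _ eq])
      show "Ck_on k S (\<lambda>x. \<Sum>b\<in>Basis. (frechet_derivative f (at x) v \<bullet> b) *\<^sub>R
          frechet_derivative g (at (f x)) b)"
      proof (intro Ck_on_sum Ck_on_bilinear[OF bounded_bilinear_scaleR]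
          Ck_on_bilinear[OF bounded_bilinear_inner] Ck_on_const \<open>open S\<close> Suc.IH)
        show "Ck_on k S f" using Suc.prems(1) by (rule Ck_on_Suc_D)
      qed (use Suc.prems in auto)
    qed auto
  qed
qed

section \<open>Closure properties of smooth maps and derivatives of smooth curves\<close>

lemma smooth_on_imp_Ck_on: "smooth_on S f \<Longrightarrow> Ck_on k S f"
  by (simp add: smooth_on_def)

lemma smooth_on_imp_has_derivative:
  "smooth_on S f \<Longrightarrow> x \<in> S \<Longrightarrow> (f has_derivative frechet_derivative f (at x)) (at x)"
  by (rule Ck_on_Suc_derivative[OF smooth_on_imp_Ck_on])

lemma smooth_on_imp_continuous_on: "smooth_on S f \<Longrightarrow> continuous_on S f"
  by (rule Ck_on_imp_continuous_on[OF smooth_on_imp_Ck_on])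

lemma smooth_on_frechet_derivative:
  "smooth_on S f \<Longrightarrow> smooth_on S (\<lambda>x. frechet_derivative f (at x) v)"
  unfolding smooth_on_def by (metis Ck_on.simps(2))

lemma smooth_on_compose:
  "open S \<Longrightarrow> smooth_on S f \<Longrightarrow> smooth_on T g \<Longrightarrow> f ` S \<subseteq> T \<Longrightarrow> smooth_on S (\<lambda>x. g (f x))"
  unfolding smooth_on_def by (blast intro: Ck_on_compose)

lemma smooth_on_subset: "smooth_on S f \<Longrightarrow> T \<subseteq> S \<Longrightarrow> smooth_on T f"
  unfolding smooth_on_def by (blast intro: Ck_on_subset)

lemma smooth_on_cong:
  "open S \<Longrightarrow> smooth_on S f \<Longrightarrow> (\<And>x. x \<in> S \<Longrightarrow> f x = g x) \<Longrightarrow> smooth_on S g"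
  unfolding smooth_on_def by (blast intro: Ck_on_cong)

lemma smooth_on_UN:
  "(\<And>i. i \<in> X \<Longrightarrow> open (S i)) \<Longrightarrow> (\<And>i. i \<in> X \<Longrightarrow> smooth_on (S i) f) \<Longrightarrow>
    smooth_on (\<Union>i\<in>X. S i) f"
  unfolding smooth_on_def by (blast intro: Ck_on_UN)

lemma smooth_on_const: "open S \<Longrightarrow> smooth_on S (\<lambda>x. a)"
  unfolding smooth_on_def by (blast intro: Ck_on_const)

lemma smooth_on_bounded_linear: "open S \<Longrightarrow> bounded_linear L \<Longrightarrow> smooth_on S L"
  unfolding smooth_on_def by (blast intro: Ck_on_bounded_linear)

lemma smooth_on_add:
  "open S \<Longrightarrow> smooth_on S f \<Longrightarrow> smooth_on S g \<Longrightarrow> smooth_on S (\<lambda>x. f x + g x)"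
  unfolding smooth_on_def by (blast intro: Ck_on_add)

lemma smooth_on_bilinear:
  fixes f :: "'a::euclidean_space \<Rightarrow> 'b::euclidean_space" and g :: "'a \<Rightarrow> 'c::euclidean_space"
    and prod :: "'b \<Rightarrow> 'c \<Rightarrow> 'd::euclidean_space"
  shows "bounded_bilinear prod \<Longrightarrow> open S \<Longrightarrow> smooth_on S f \<Longrightarrow> smooth_on S g \<Longrightarrow>
    smooth_on S (\<lambda>x. prod (f x) (g x))"
  unfolding smooth_on_def by (blast intro: Ck_on_bilinear)

lemmas smooth_on_scaleR = smooth_on_bilinear[OF bounded_bilinear_scaleR]
lemmas smooth_on_mult = smooth_on_bilinear[OF bounded_bilinear_mult]

lemma smooth_on_vector_derivative:
  fixes c :: "real \<Rightarrow> 'b::euclidean_space"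
  assumes "open S" "smooth_on S c"
  shows "smooth_on S (\<lambda>u. vector_derivative c (at u))"
proof (rule smooth_on_cong[OF assms(1) smooth_on_frechet_derivative[OF assms(2), of 1]])
  show "frechet_derivative c (at u) 1 = vector_derivative c (at u)" if "u \<in> S" for u
    using frechet_derivative_eq_vector_derivative[OF
        differentiableI[OF smooth_on_imp_has_derivative[OF assms(2) that]]]
    by simp
qed

lemma smooth_on_imp_has_vector_derivative:
  fixes c :: "real \<Rightarrow> 'b::euclidean_space"
  assumes "smooth_on S c" "u \<in> S"
  shows "(c has_vector_derivative vector_derivative c (at u)) (at u)"
  using differentiableI[OF smooth_on_imp_has_derivative[OF assms]]
  by (simp flip: vector_derivative_works)

section \<open>Curves whose velocity has a simple zero\<close>

text \<open>\<open>the_inv_into I S t\<close> is meaningful only if \<open>t\<close> has a single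
  preimage in the whole of \<open>I\<close>. Weak monotonicity on \<open>I\<close> prevents far away
  points from taking values near \<open>0\<close>, while strictness near \<open>0\<close> gives
  uniqueness there.\<close>

lemma the_inv_into_tendsto_0:
  fixes S :: "real \<Rightarrow> real"
  assumes "0 < d" "{-d<..<d} \<subseteq> I" and S0: "S 0 = 0"
    and mono: "\<And>x y. x \<in> I \<Longrightarrow> y \<in> I \<Longrightarrow> x \<le> y \<Longrightarrow> S x \<le> S y"
    and strict: "\<And>x y. -d < x \<Longrightarrow> x < y \<Longrightarrow> y < d \<Longrightarrow> S x < S y"
    and cont: "continuous_on {-d<..<d} S"
  shows "filterlim (the_inv_into I S) (at 0) (at 0)"
    and "\<forall>\<^sub>F t in at 0. S (the_inv_into I S t) = t"
proof -
  have key: "\<bar>the_inv_into I S t\<bar> < e \<and> S (the_inv_into I S t) = t"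
    if e: "0 < e" "e < d" and t: "S (-e) < t" "t < S e" for e t
  proof -
    have "continuous_on {-e..e} S"
      by (rule continuous_on_subset[OF cont]) (use e in auto)
    then obtain u where u: "-e \<le> u" "u \<le> e" "S u = t"
      using IVT'[of S "-e" t e] t e by auto
    with t have u': "-e < u" "u < e" by (auto simp: less_le)
    have inI: "x \<in> I" if "-e \<le> x" "x \<le> e" for x
      using assms(2) that e by auto
    have uniq: "x = u" if x: "x \<in> I" "S x = t" for x
    proof (rule ccontr)
      assume "x \<noteq> u"
      then consider "x < u" | "u < x" by linarith
      then show False
      proof cases
        case 1
        \<comment> \<open>A competitor \<open>x\<close> outside \<open>{-e..e}\<close> is clipped to
          the endpoint: strictness separates the clipped point from \<open>u\<close>, and weak
          monotonicity carries this over to \<open>x\<close>.\<close>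
        have "S (max x (-e)) < S u" by (rule strict) (use 1 u' e in auto)
        moreover have "S x \<le> S (max x (-e))"
          by (rule mono) (use x inI[of "-e"] e in \<open>auto simp: max_def\<close>)
        ultimately show False using u x by simp
      next
        case 2
        have "S u < S (min x e)" by (rule strict) (use 2 u' e in auto)
        moreover have "S (min x e) \<le> S x"
          by (rule mono) (use x inI[of e] e in \<open>auto simp: min_def\<close>)
        ultimately show False using u x by simp
      qed
    qed
    have "the_inv_into I S t = u"
      unfolding the_inv_into_def by (rule the_equality) (use u u' inI uniq in auto)
    then show ?thesis using u u' by auto
  qed
  have ev: "\<forall>\<^sub>F t in at 0. \<bar>the_inv_into I S t\<bar> < e \<and> S (the_inv_into I S t) = t"
    if "0 < e" "e < d" for e
  proof -
    have "S (-e) < 0" "0 < S e"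
      using strict[of "-e" 0] strict[of 0 e] that S0 by auto
    then have "\<forall>\<^sub>F t in at 0. t \<in> {S (-e)<..<S e}"
      by (intro eventually_at_in_open') auto
    then show ?thesis by eventually_elim (use key[OF that] in auto)
  qed
  show inv: "\<forall>\<^sub>F t in at 0. S (the_inv_into I S t) = t"
    using ev[of "d/2"] \<open>0 < d\<close> by (auto elim: eventually_mono)
  show "filterlim (the_inv_into I S) (at 0) (at 0)"
  proof (rule filterlim_atI)
    show "(the_inv_into I S \<longlongrightarrow> 0) (at 0)"
    proof (rule tendstoI)
      fix e :: real assume "0 < e"
      with ev[of "min e (d/2)"] \<open>0 < d\<close>
      show "\<forall>\<^sub>F t in at 0. dist (the_inv_into I S t) 0 < e"
        by (simp add: dist_real_def eventually_conj_iff)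
    qed
    show "\<forall>\<^sub>F t in at 0. the_inv_into I S t \<noteq> 0"
      using inv eventually_neq_at_within[of 0 0 UNIV]
      by eventually_elim (use S0 in auto)
  qed
qed

section \<open>Signed arclength\<close>

lemma arclength_has_derivative:
  assumes "open I" "is_interval I" "0 \<in> I" "u \<in> I"
    and cont: "continuous_on I (nth_deriv 1 c)"
  shows "(arclength c has_real_derivative norm (nth_deriv 1 c u)) (at u)"
proof -
  obtain e where e: "0 < e" "cball u e \<subseteq> I" using assms(1,4) open_contains_cball by blast
  have ue: "u - e \<in> I" "u + e \<in> I" using e by (auto simp: dist_real_def subset_iff)
  \<comment> \<open>This compact interval contains the base point \<open>0\<close> of the integral
    and has \<open>u\<close> in its interior, so the derivative within it is a full
    derivative.\<close>
  define a b where "a = min 0 (u - e)" and "b = max 0 (u + e)"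
  have ab: "a \<in> I" "b \<in> I" using ue assms(3) by (auto simp: a_def b_def min_def max_def)
  have sub: "{a..b} \<subseteq> I"
    using mem_is_interval_1_I[OF assms(2) ab] by auto
  have "continuous_on {a..b} (\<lambda>x. norm (nth_deriv 1 c x))"
    by (intro continuous_intros continuous_on_subset[OF cont sub])
  then have "((\<lambda>u. LBINT y=(0::real)..u. norm (nth_deriv 1 c y)) has_vector_derivative
      norm (nth_deriv 1 c u)) (at u within {a..b})"
    using e by (intro interval_integral_FTC2) (auto simp: a_def b_def)
  moreover have "at u within {a..b} = at u"
    by (rule at_within_Icc_at) (use e in \<open>auto simp: a_def b_def\<close>)
  moreover have "arclength c = (\<lambda>u. LBINT y=(0::real)..u. norm (nth_deriv 1 c y))"
    by (simp add: arclength_def fun_eq_iff zero_ereal_def)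
  ultimately show ?thesis
    by (simp add: has_real_derivative_iff_has_vector_derivative)
qed

lemma arclength_0: "arclength c 0 = 0"
  by (simp add: arclength_def zero_ereal_def)

section \<open>Iterated derivatives of a curve with factorized velocity\<close>

lemma nth_deriv_Suc: "nth_deriv (Suc n) c u = vector_derivative (nth_deriv n c) (at u)"
  by (simp add: nth_deriv_def)

lemma nth_deriv_0: "nth_deriv 0 c = c"
  by (simp add: nth_deriv_def)

lemma nth_deriv_SucI:
  assumes "open J" "u \<in> J" "\<And>s. s \<in> J \<Longrightarrow> nth_deriv n c s = g s" "(g has_vector_derivative d) (at u)"
  shows "nth_deriv (Suc n) c u = d"
  unfolding nth_deriv_Suc
  using vector_derivative_at[OF has_vector_derivative_transform_within_open[OF assms(4,1,2)]]
    assms(3) by simp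

text \<open>The velocity is \<open>m w\<close> with \<open>m\<close> having a simple zero at
  \<open>0\<close>. The constants \<open>m''\<close> and \<open>w''\<close> are second derivatives
  at \<open>0\<close> only, enough for the third derivative of \<open>c\<close> there. The codomain
  is left general so that a space curve and its planar projection are both instances.\<close>

locale cuspidal_curve =
  fixes J :: "real set" and c w w' :: "real \<Rightarrow> 'b::real_normed_vector"
    and m m' :: "real \<Rightarrow> real" and m'' :: real and w'' :: 'b
  assumes J: "open J" "0 \<in> J"
    and c: "\<And>s. s \<in> J \<Longrightarrow> (c has_vector_derivative m s *\<^sub>R w s) (at s)"
    and m: "\<And>s. s \<in> J \<Longrightarrow> (m has_real_derivative m' s) (at s)"
    and w: "\<And>s. s \<in> J \<Longrightarrow> (w has_vector_derivative w' s) (at s)"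
    and m': "(m' has_real_derivative m'') (at 0)"
    and w': "(w' has_vector_derivative w'') (at 0)"
    and m0: "m 0 = 0" "m' 0 \<noteq> 0"
    and w0: "w 0 \<noteq> 0"
begin

lemma deriv1: "s \<in> J \<Longrightarrow> nth_deriv 1 c s = m s *\<^sub>R w s"
  using nth_deriv_SucI[OF J(1) _ _ c, of s 0] by (simp add: nth_deriv_0)

lemma deriv2: "s \<in> J \<Longrightarrow> nth_deriv 2 c s = m s *\<^sub>R w' s + m' s *\<^sub>R w s"
  using nth_deriv_SucI[OF J(1) _ deriv1 has_vector_derivative_scaleR[OF m w], of s]
  by (simp add: numeral_2_eq_2)

text \<open>The term with \<open>w''\<close> carries the factor \<open>m 0 = 0\<close>, and the
  mixed term \<open>m' w'\<close> arises twice.\<close>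

lemma deriv3: "nth_deriv 3 c 0 = m'' *\<^sub>R w 0 + (2 * m' 0) *\<^sub>R w' 0"
proof -
  have "(m 0 *\<^sub>R w'' + m' 0 *\<^sub>R w' 0) + (m' 0 *\<^sub>R w' 0 + m'' *\<^sub>R w 0) =
      m'' *\<^sub>R w 0 + (2 * m' 0) *\<^sub>R w' 0"
    unfolding mult_2 scaleR_add_left by (simp add: m0)
  then have "((\<lambda>s. m s *\<^sub>R w' s + m' s *\<^sub>R w s) has_vector_derivative
      m'' *\<^sub>R w 0 + (2 * m' 0) *\<^sub>R w' 0) (at 0)"
    using has_vector_derivative_add[OF has_vector_derivative_scaleR[OF m[OF J(2)] w']
        has_vector_derivative_scaleR[OF m' w[OF J(2)]]]
    by (simp only:)
  from nth_deriv_SucI[OF J(1,2) deriv2 this]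
  have "nth_deriv (Suc 2) c 0 = m'' *\<^sub>R w 0 + (2 * m' 0) *\<^sub>R w' 0" .
  then show ?thesis by (simp only: numeral_3_eq_3 numeral_2_eq_2)
qed

lemma m_over_s: "((\<lambda>s. m s / s) \<longlongrightarrow> m' 0) (at 0)"
  using m[OF J(2)] by (simp add: has_field_derivative_iff m0)

lemma eventually_J: "\<forall>\<^sub>F s in at 0. s \<in> J"
  using J by (rule eventually_at_in_open')

lemma tendsto_w: "(w \<longlongrightarrow> w 0) (at 0)" and tendsto_w': "(w' \<longlongrightarrow> w' 0) (at 0)"
  using has_vector_derivative_continuous[OF w[OF J(2)]] has_vector_derivative_continuous[OF w']
  by (auto simp: isCont_def)

lemma eventually_regular: "\<forall>\<^sub>F s in at 0. s \<in> J \<and> m s \<noteq> 0 \<and> w s \<noteq> 0"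
proof -
  have "\<forall>\<^sub>F s in at 0. m s / s \<noteq> 0"
    using tendsto_imp_eventually_ne[OF m_over_s m0(2)] .
  moreover have "\<forall>\<^sub>F s in at 0. w s \<noteq> 0"
    using tendsto_imp_eventually_ne[OF tendsto_w w0] .
  ultimately show ?thesis using eventually_J by eventually_elim auto
qed

end

section \<open>Arclength and singular curvature of a space curve with factorized velocity\<close>

locale cuspidal_space_curve = cuspidal_curve J c w w' m m' m'' w''
  for J and c w w' :: "real \<Rightarrow> real^3" and m m' m'' w''
begin

text \<open>The summand \<open>m' w\<close> of the second derivative is parallel to the velocity
  \<open>m w\<close> and drops out, so the identity is exact and not merely asymptotic.\<close>

lemma det_deriv:
  assumes "s \<in> J"
  shows "det (vector [nth_deriv 1 c s, nth_deriv 2 c s, n] :: real^3^3) =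
    (m s)\<^sup>2 * det (vector [w s, w' s, n] :: real^3^3)"
  unfolding deriv1[OF assms] deriv2[OF assms]
  by (simp add: det_3 power2_eq_square algebra_simps)

context
  fixes I assumes I: "open I" "is_interval I" "0 \<in> I" "continuous_on I (nth_deriv 1 c)"
begin

text \<open>L'Hospital's rule. The comparison function is \<open>s * \<bar>s\<bar>\<close> and not
  the square of \<open>s\<close> because the arclength is signed; its derivative is
  \<open>2 * \<bar>s\<bar>\<close>, and the speed is
  \<open>\<bar>m s\<bar> * norm (w s)\<close>.\<close>

lemma arclength_over_square:
  "((\<lambda>s. arclength c s / (s * \<bar>s\<bar>)) \<longlongrightarrow> \<bar>m' 0\<bar> * norm (w 0) / 2) (at 0)"
proof (rule lhopital[where f' = "\<lambda>s. norm (nth_deriv 1 c s)" and g' = "\<lambda>s. 2 * \<bar>s\<bar>"])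
  have "isCont (arclength c) 0"
    using arclength_has_derivative[OF I(1-3) I(3,4)] by (rule DERIV_isCont)
  then show "(arclength c \<longlongrightarrow> 0) (at 0)" by (simp add: isCont_def arclength_0)
  show "((\<lambda>s::real. s * \<bar>s\<bar>) \<longlongrightarrow> 0) (at 0)" by (auto intro!: tendsto_eq_intros)
  have ne: "\<forall>\<^sub>F s in at (0::real). s \<noteq> 0" by (rule eventually_neq_at_within)
  then show "\<forall>\<^sub>F s in at (0::real). s * \<bar>s\<bar> \<noteq> 0" "\<forall>\<^sub>F s in at (0::real). 2 * \<bar>s\<bar> \<noteq> 0"
    by (auto elim: eventually_mono)
  show "\<forall>\<^sub>F s in at 0. (arclength c has_real_derivative norm (nth_deriv 1 c s)) (at s)"
    using eventually_at_in_open'[OF I(1,3)]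
    by eventually_elim (rule arclength_has_derivative[OF I(1-3) _ I(4)])
  show "\<forall>\<^sub>F s in at (0::real). ((\<lambda>s. s * \<bar>s\<bar>) has_real_derivative 2 * \<bar>s\<bar>) (at s)"
    using ne
  proof eventually_elim
    case (elim s)
    \<comment> \<open>On the half line containing \<open>s\<close> the absolute value is the linear
      function \<open>sgn s * x\<close>, which can be differentiated.\<close>
    define U where "U = (if 0 < s then {0<..} else {..<0::real})"
    let ?g = "\<lambda>x. x * (sgn s * x)"
    have g: "(?g has_real_derivative 2 * \<bar>s\<bar>) (at s)"
      by (auto intro!: derivative_eq_intros simp: abs_sgn)
    have eq: "?g x = x * \<bar>x\<bar>" if "x \<in> U" for x
      using that elim by (auto simp: U_def split: if_splits)
    have U: "open U" "s \<in> U"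
      using elim by (auto simp: U_def)
    from g U eq show ?case by (rule has_field_derivative_transform_within_open)
  qed
  have "((\<lambda>s. \<bar>m s / s\<bar> * norm (w s) / 2) \<longlongrightarrow> \<bar>m' 0\<bar> * norm (w 0) / 2) (at 0)"
    by (intro tendsto_intros m_over_s tendsto_w) auto
  moreover have "\<forall>\<^sub>F s in at 0. \<bar>m s / s\<bar> * norm (w s) / 2 = norm (nth_deriv 1 c s) / (2 * \<bar>s\<bar>)"
    using eventually_J by eventually_elim (simp add: deriv1 del: One_nat_def)
  ultimately show "((\<lambda>s. norm (nth_deriv 1 c s) / (2 * \<bar>s\<bar>)) \<longlongrightarrow> \<bar>m' 0\<bar> * norm (w 0) / 2) (at 0)"
    by (simp cong: tendsto_cong del: One_nat_def)
qed

text \<open>The speed vanishes at \<open>0\<close> and is known to be positive only for small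
  nonzero parameters. Strict growth is therefore shown near \<open>0\<close> alone, first on
  intervals not straddling \<open>0\<close> and then by joining two of them at \<open>0\<close>; on
  the rest of \<open>I\<close> weak growth is enough.\<close>

lemma inverse_arclength:
  shows "filterlim (the_inv_into I (arclength c)) (at 0) (at 0)"
    and "\<forall>\<^sub>F t in at 0. arclength c (the_inv_into I (arclength c) t) = t"
proof -
  obtain d where d: "0 < d" "\<And>s. s \<noteq> 0 \<Longrightarrow> \<bar>s\<bar> < d \<Longrightarrow> s \<in> I \<and> s \<in> J \<and> m s \<noteq> 0 \<and> w s \<noteq> 0"
    using eventually_conj[OF eventually_at_in_open'[OF I(1,3)] eventually_regular]
    by (auto simp: eventually_at dist_real_def)
  have dI: "{-d<..<d} \<subseteq> I"
  proof
    show "s \<in> I" if "s \<in> {-d<..<d}" for s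
      using that d(2)[of s] I(3) by (cases "s = 0") auto
  qed
  note der = arclength_has_derivative[OF I(1-3) _ I(4)]
  have mono: "arclength c x \<le> arclength c y" if "x \<in> I" "y \<in> I" "x \<le> y" for x y
  proof (rule DERIV_nonneg_imp_nondecreasing[OF that(3)])
    fix u assume "x \<le> u" "u \<le> y"
    then have "u \<in> I" by (rule mem_is_interval_1_I[OF I(2) that(1,2)])
    from der[OF this] show "\<exists>d. (arclength c has_real_derivative d) (at u) \<and> 0 \<le> d" by auto
  qed
  have cont: "continuous_on {-d<..<d} (arclength c)"
    using dI by (auto intro!: continuous_at_imp_continuous_on DERIV_isCont[OF der])
  have pos: "arclength c x < arclength c y" if "-d < x" "x < y" "y < d" "0 \<le> x \<or> y \<le> 0" for x y
  proof (rule DERIV_pos_imp_increasing_open[OF that(2)])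
    fix u assume u: "x < u" "u < y"
    with d(2)[of u] that have "u \<in> I" "0 < norm (nth_deriv 1 c u)" by (auto simp: deriv1 simp del: One_nat_def)
    with der show "\<exists>d. (arclength c has_real_derivative d) (at u) \<and> 0 < d" by blast
  qed (use that in \<open>auto intro: continuous_on_subset[OF cont]\<close>)
  have strict: "arclength c x < arclength c y" if "-d < x" "x < y" "y < d" for x y
  proof (cases "0 \<le> x \<or> y \<le> 0")
    case False
    then have "arclength c x < arclength c 0" "arclength c 0 < arclength c y"
      using that by (auto intro!: pos)
    then show ?thesis by simp
  qed (use pos that in blast)
  note inv = the_inv_into_tendsto_0[OF d(1) dI arclength_0 mono strict cont]
  show "filterlim (the_inv_into I (arclength c)) (at 0) (at 0)"
    by (rule inv)
  show "\<forall>\<^sub>F t in at 0. arclength c (the_inv_into I (arclength c) t) = t"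
    by (rule inv)
qed

text \<open>By \<open>det_deriv\<close> the curvature is \<open>1 / \<bar>m s\<bar>\<close> times a
  convergent factor, and the root of the arclength is of order \<open>\<bar>s\<bar>\<close>, as is
  \<open>m s\<close>. The limit is computed in the parameter \<open>s\<close> and then transported
  to the arclength parameter.\<close>

lemma tendsto_scaled_sing_curv:
  assumes n: "(n \<longlongrightarrow> n0) (at 0)"
  shows "((\<lambda>t. sqrt \<bar>t\<bar> * (\<lambda>u. \<bar>det (vector [nth_deriv 1 c u, nth_deriv 2 c u, n u] :: real^3^3)\<bar>
       / norm (nth_deriv 1 c u) ^ 3) (the_inv_into I (arclength c) t)) \<longlongrightarrow>
    sqrt (\<bar>m' 0\<bar> * norm (w 0) / 2) / \<bar>m' 0\<bar> *
      (\<bar>det (vector [w 0, w' 0, n0] :: real^3^3)\<bar> / norm (w 0) ^ 3)) (at 0)"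
    (is "(_ \<longlongrightarrow> ?L) (at 0)")
proof -
  let ?K = "\<lambda>u. \<bar>det (vector [nth_deriv 1 c u, nth_deriv 2 c u, n u] :: real^3^3)\<bar>
       / norm (nth_deriv 1 c u) ^ 3"
  let ?u = "the_inv_into I (arclength c)"
  have "((\<lambda>s. sqrt \<bar>arclength c s / (s * \<bar>s\<bar>)\<bar> / \<bar>m s / s\<bar> *
      (\<bar>det (vector [w s, w' s, n s] :: real^3^3)\<bar> / norm (w s) ^ 3)) \<longlongrightarrow>
    sqrt \<bar>\<bar>m' 0\<bar> * norm (w 0) / 2\<bar> / \<bar>m' 0\<bar> *
      (\<bar>det (vector [w 0, w' 0, n0] :: real^3^3)\<bar> / norm (w 0) ^ 3)) (at 0)"
    unfolding det_3 vector_3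
    by (intro tendsto_intros arclength_over_square m_over_s tendsto_w tendsto_w' n)
      (use m0 w0 in auto)
  moreover have "\<forall>\<^sub>F s in at 0. sqrt \<bar>arclength c s / (s * \<bar>s\<bar>)\<bar> / \<bar>m s / s\<bar> *
      (\<bar>det (vector [w s, w' s, n s] :: real^3^3)\<bar> / norm (w s) ^ 3) =
    sqrt \<bar>arclength c s\<bar> * ?K s"
    using eventually_regular eventually_neq_at_within[of 0 0 UNIV]
  proof eventually_elim
    case (elim s)
    have "sqrt \<bar>arclength c s / (s * \<bar>s\<bar>)\<bar> = sqrt \<bar>arclength c s\<bar> / \<bar>s\<bar>"
      by (simp add: abs_mult real_sqrt_divide real_sqrt_mult)
    \<comment> \<open>Here \<open>a\<close> stands for the root of the arclength, \<open>b\<close>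
      for \<open>norm (w s)\<close> and \<open>D\<close> for the determinant. The factors
      \<open>\<bar>s\<bar>\<close> cancel, and the square of \<open>m s\<close> cancels against its
      cube.\<close>
    moreover have "a / \<bar>s\<bar> / \<bar>m s / s\<bar> * (\<bar>D\<bar> / b ^ 3) = a * (\<bar>(m s)\<^sup>2 * D\<bar> / (\<bar>m s\<bar> * b) ^ 3)"
      if "b \<noteq> 0" for a b D
      using elim that by (simp add: abs_mult power_mult_distrib power2_eq_square power3_eq_cube
          divide_simps)
    ultimately show ?case
      using elim det_deriv[of s "n s"] deriv1[of s] by (simp del: One_nat_def)
  qed
  ultimately have "((\<lambda>s. sqrt \<bar>arclength c s\<bar> * ?K s) \<longlongrightarrow>
    sqrt \<bar>\<bar>m' 0\<bar> * norm (w 0) / 2\<bar> / \<bar>m' 0\<bar> *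
      (\<bar>det (vector [w 0, w' 0, n0] :: real^3^3)\<bar> / norm (w 0) ^ 3)) (at 0)"
    by (rule Lim_transform_eventually)
  then have "((\<lambda>s. sqrt \<bar>arclength c s\<bar> * ?K s) \<longlongrightarrow> ?L) (at 0)"
    by (simp only: abs_mult abs_divide abs_idempotent abs_norm_cancel abs_numeral)
  \<comment> \<open>The inverse arclength tends to \<open>0\<close> without taking the value
    \<open>0\<close> for small nonzero \<open>t\<close>, so it may be substituted into a punctured
    limit.\<close>
  from filterlim_compose[OF this inverse_arclength(1)]
  have "((\<lambda>t. sqrt \<bar>arclength c (?u t)\<bar> * ?K (?u t)) \<longlongrightarrow> ?L) (at 0)" .
  then show ?thesis
    by (rule Lim_transform_eventually)
      (use inverse_arclength(2) in \<open>auto elim: eventually_mono\<close>)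
qed

end

end

section \<open>Projection to the tangential plane\<close>

lemma orth_proj_tangential_plane:
  assumes "norm (\<nu> p) = 1"
  shows "orth_proj (tangential_plane f \<nu> p) x = x - ((x - f p) \<bullet> \<nu> p) *\<^sub>R \<nu> p"
    (is "_ = ?y")
  unfolding orth_proj_def
proof (rule the_equality)
  have n: "\<nu> p \<bullet> \<nu> p = 1" using assms by (simp add: norm_eq_1)
  have y: "?y \<in> tangential_plane f \<nu> p"
    using n by (simp add: tangential_plane_def inner_diff_left)
  have y': "(x - ?y) \<bullet> (z - ?y) = 0" if "z \<in> tangential_plane f \<nu> p" for z
  proof -
    have "(z - f p) \<bullet> \<nu> p - (?y - f p) \<bullet> \<nu> p = 0"
      using that y by (simp add: tangential_plane_def)
    then have "\<nu> p \<bullet> (z - ?y) = 0" by (simp add: inner_diff_left inner_diff_right inner_commute)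
    then show ?thesis by simp
  qed
  show "?y \<in> tangential_plane f \<nu> p \<and> (\<forall>z\<in>tangential_plane f \<nu> p. (x - ?y) \<bullet> (z - ?y) = 0)"
    using y y' by blast
  fix u assume u: "u \<in> tangential_plane f \<nu> p \<and>
    (\<forall>z\<in>tangential_plane f \<nu> p. (x - u) \<bullet> (z - u) = 0)"
  \<comment> \<open>Uniqueness of the foot point: the squared distance of two candidates splits into
    one orthogonality relation for each of them.\<close>
  have "(?y - u) \<bullet> (?y - u) = (x - u) \<bullet> (?y - u) + (x - ?y) \<bullet> (u - ?y)"
    by (simp add: inner_diff_left inner_diff_right inner_commute algebra_simps)
  also have "\<dots> = 0" using u y y' by simp
  finally show "u = ?y" by simp
qed

section \<open>Orthonormal coordinates in the plane orthogonal to a unit vector\<close>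

locale orthonormal_frame =
  fixes n e1 e2 :: "real^3"
  assumes norms: "norm n = 1" "norm e1 = 1" "norm e2 = 1"
    and orth: "e1 \<bullet> e2 = 0" "e1 \<bullet> n = 0" "e2 \<bullet> n = 0"
begin

definition coords :: "real^3 \<Rightarrow> real^2" where
  "coords v = vector [v \<bullet> e1, v \<bullet> e2]"

lemma linear_coords: "linear coords"
  by (rule linearI) (simp_all add: coords_def vec_eq_iff forall_2 inner_add_left)

lemma coords_eq_0_iff: "coords v = 0 \<longleftrightarrow> v \<bullet> e1 = 0 \<and> v \<bullet> e2 = 0"
  by (simp add: coords_def vec_eq_iff forall_2)

lemma plane_coords_eq: "plane_coords q e1 e2 x = coords x - coords q"
  by (simp add: plane_coords_def coords_def vec_eq_iff forall_2 inner_diff_left)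

lemma coords_normal: "coords (r *\<^sub>R n) = 0"
  using orth by (simp add: coords_def vec_eq_iff forall_2 inner_commute[of n])

lemma orthogonal_frame_matrix: "orthogonal_matrix (vector [e1, e2, n] :: real^3^3)"
  using norms orth
  by (simp add: orthogonal_matrix_orthonormal_rows forall_3 row_def
      pairwise_def orthogonal_def inner_commute)

text \<open>Passing to the frame \<open>e1, e2, n\<close> multiplies by an orthogonal matrix and
  makes the determinant block diagonal. The orientation of the frame is not fixed, so its
  determinant is \<open>1\<close> or \<open>-1\<close> and only absolute values agree.\<close>

lemma abs_det_coords:
  assumes "a \<bullet> n = 0" "b \<bullet> n = 0"
  shows "\<bar>det (vector [a, b, n] :: real^3^3)\<bar> = \<bar>det (vector [coords a, coords b] :: real^2^2)\<bar>"
proof -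
  let ?Q = "vector [e1, e2, n] :: real^3^3" and ?M = "vector [a, b, n] :: real^3^3"
  have n: "n \<bullet> n = 1" using norms(1) by (simp add: norm_eq_1)
  have "(?M ** transpose ?Q) $ i $ j = ?M $ i \<bullet> ?Q $ j" for i j
    by (simp add: matrix_matrix_mult_def transpose_def inner_vec_def)
  then have MQ: "?M ** transpose ?Q = vector [vector [a \<bullet> e1, a \<bullet> e2, 0],
      vector [b \<bullet> e1, b \<bullet> e2, 0], vector [0, 0, 1]]"
    using assms orth n
    by (simp add: vec_eq_iff forall_3 inner_commute)
  have "det ?M * det ?Q = det (?M ** transpose ?Q)"
    by (simp only: det_mul det_transpose)
  also have "\<dots> = det (vector [coords a, coords b] :: real^2^2)"
    unfolding MQ by (simp add: det_3 det_2 coords_def)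
  finally have "det ?M * det ?Q = det (vector [coords a, coords b] :: real^2^2)" .
  moreover have "\<bar>det ?Q\<bar> = 1"
    using det_orthogonal_matrix[OF orthogonal_frame_matrix] by auto
  ultimately show ?thesis by (metis abs_mult mult.right_neutral)
qed

text \<open>An orthogonal matrix preserves norms, and the third new coordinate
  \<open>a \<bullet> n\<close> vanishes.\<close>

lemma norm_coords:
  assumes "a \<bullet> n = 0"
  shows "norm (coords a) = norm a"
proof -
  let ?Q = "vector [e1, e2, n] :: real^3^3"
  have "norm a = norm (?Q *v a)"
    using orthogonal_frame_matrix orthogonal_transformation_norm[of "(*v) ?Q"]
    by (simp add: orthogonal_transformation_matrix)
  also have "\<dots> = norm (coords a)"
    using assms by (simp add: norm_vec_def L2_set_def sum_3 sum_2 matrix_vector_mul_component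
        coords_def inner_commute)
  finally show ?thesis by simp
qed

lemma det_coords_nonzero:
  assumes "a \<bullet> n = 0" "b \<bullet> n = 0" and indep: "\<And>r s. r *\<^sub>R a + s *\<^sub>R b = 0 \<Longrightarrow> r = 0 \<and> s = 0"
  shows "det (vector [coords a, coords b] :: real^2^2) \<noteq> 0"
proof
  assume "det (vector [coords a, coords b] :: real^2^2) = 0"
  then have det: "(a \<bullet> e1) * (b \<bullet> e2) = (a \<bullet> e2) * (b \<bullet> e1)"
    by (simp add: det_2 coords_def)
  have zero: "coords v = 0 \<longleftrightarrow> v = 0" if "v \<bullet> n = 0" for v
    using norm_coords[OF that] by (metis norm_eq_zero)
  \<comment> \<open>A vanishing determinant supplies these linear relations between \<open>a\<close>
    and \<open>b\<close>. Independence makes their coefficients zero, so both coordinates of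
    \<open>a\<close> vanish.\<close>
  have *: "((b \<bullet> e) *\<^sub>R a + (- (a \<bullet> e)) *\<^sub>R b) = 0" if "e \<in> {e1, e2}" for e
  proof (subst zero[symmetric])
    show "((b \<bullet> e) *\<^sub>R a + (- (a \<bullet> e)) *\<^sub>R b) \<bullet> n = 0"
      using assms by (simp add: inner_diff_left)
    show "coords ((b \<bullet> e) *\<^sub>R a + (- (a \<bullet> e)) *\<^sub>R b) = 0"
    proof -
      consider "e = e1" | "e = e2" using \<open>e \<in> {e1, e2}\<close> by blast
      then show ?thesis
        by cases (use det in \<open>simp_all add: coords_eq_0_iff inner_diff_left algebra_simps\<close>)
    qed
  qed
  have "a \<bullet> e1 = 0" "a \<bullet> e2 = 0"
    using indep[OF *[of e1]] indep[OF *[of e2]] by auto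
  then have "a = 0"
    using zero[OF assms(1)] by (simp add: coords_eq_0_iff)
  with indep[of 1 0] show False by simp
qed

end

text \<open>To be read with \<open>a = \<bar>m' 0\<bar>\<close> and \<open>b = norm (w 0)\<close>:
  the left side is the limiting singular curvature, the right side the absolute cuspidal curvature.
  The normalization \<open>2 * sqrt 2\<close> absorbs the \<open>1/2\<close> in the asymptotics of
  the arclength and leaves the factor \<open>2\<close>.\<close>

lemma sqrt_powr_identity:
  fixes a b D :: real
  assumes "0 < a" "0 < b"
  shows "2 * sqrt 2 * (sqrt (a * b / 2) / a * (D / b ^ 3)) = (2 * a\<^sup>2 * D) / (a * b) powr (5/2)"
proof -
  have "(a * b) powr (5/2) = (a * b) powr (2 + 1/2)" by simp
  also have "\<dots> = (a * b)\<^sup>2 * sqrt (a * b)"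
    using assms by (simp only: powr_add powr_half_sqrt powr_numeral mult_pos_pos less_imp_le)
  finally have *: "(a * b) powr (5/2) = (a * b)\<^sup>2 * sqrt (a * b)" .
  have "sqrt (a * b) * sqrt (a * b) = a * b" using assms by simp
  then show ?thesis
    unfolding * using assms
    by (simp add: real_sqrt_divide field_simps power2_eq_square power3_eq_cube)
qed

section \<open>Limiting singular curvature and cuspidal curvature\<close>

context cuspidal_space_curve
begin

text \<open>The projection changes \<open>c\<close> only by multiples of \<open>n0\<close>, which
  \<open>coords\<close> annihilates. The planar curve thus has velocity \<open>m\<close> times
  \<open>coords (w s)\<close>, with the same \<open>m\<close>, and both curvatures become
  expressions in \<open>m' 0\<close>, \<open>norm (w 0)\<close> and one determinant.\<close>

theorem limiting_curvature_eq_cuspidal_curvature: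
  fixes I \<nu> and q e1 e2 n0 :: "real^3"
  assumes I: "open I" "is_interval I" "0 \<in> I" "continuous_on I (nth_deriv 1 (f \<circ> \<gamma>))"
    and c_def: "c = f \<circ> \<gamma>"
    and lim: "((\<lambda>u. \<nu> (\<gamma> u)) \<longlongrightarrow> n0) (at 0)"
    and frame: "orthonormal_frame n0 e1 e2"
    and tangent: "w 0 \<bullet> n0 = 0" "w' 0 \<bullet> n0 = 0"
    and indep: "\<And>r s. r *\<^sub>R w 0 + s *\<^sub>R w' 0 = 0 \<Longrightarrow> r = 0 \<and> s = 0"
    and \<sigma>: "\<And>u. \<exists>r. \<sigma> u = c u - r *\<^sub>R n0"
  shows "three_half_cusp (plane_coords q e1 e2 \<circ> \<sigma>) \<and>
    (\<exists>l. (scaled_sing_curv f \<nu> I \<gamma> \<longlongrightarrow> l) (at 0)) \<and>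
    limiting_sing_curv f \<nu> I \<gamma> = \<bar>cuspidal_curv (plane_coords q e1 e2 \<circ> \<sigma>)\<bar>"
proof -
  interpret orthonormal_frame n0 e1 e2 by (rule frame)
  interpret L: bounded_linear coords
    using linear_coords by (rule linear_conv_bounded_linear[THEN iffD1])
  define d where "d = plane_coords q e1 e2 \<circ> \<sigma>"
  have d: "d = (\<lambda>u. coords (c u) - coords q)"
  proof
    fix u
    obtain r where "\<sigma> u = c u - r *\<^sub>R n0" using \<sigma> by blast
    then show "d u = coords (c u) - coords q"
      using L.diff[of "c u" "r *\<^sub>R n0"] by (simp add: d_def plane_coords_eq coords_normal)
  qed
  interpret d: cuspidal_curve J d "\<lambda>s. coords (w s)" "\<lambda>s. coords (w' s)" m m' m'' "coords w''"
  proof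
    show "(d has_vector_derivative m s *\<^sub>R coords (w s)) (at s)" if "s \<in> J" for s
      using has_vector_derivative_diff[OF L.has_vector_derivative[OF c[OF that]]
          has_vector_derivative_const[of "coords q"]]
      by (simp add: d L.scaleR)
    show "coords (w 0) \<noteq> 0"
      using norm_coords[OF tangent(1)] w0 by (metis norm_eq_zero)
  qed (use J m m' m0 in \<open>auto intro: L.has_vector_derivative w w'\<close>)
  let ?D = "det (vector [coords (w 0), coords (w' 0)] :: real^2^2)"
  have D: "?D \<noteq> 0" by (rule det_coords_nonzero[OF tangent indep])
  have nd1: "nth_deriv 1 d 0 = 0"
    using d.deriv1[OF J(2)] m0 by simp
  have nd2: "nth_deriv 2 d 0 = m' 0 *\<^sub>R coords (w 0)"
    using d.deriv2[OF J(2)] m0 by simp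
  \<comment> \<open>The \<open>m''\<close> part of the third derivative is parallel to the second
    derivative and disappears from the determinant.\<close>
  have cusp: "cusp_det d = 2 * (m' 0)\<^sup>2 * ?D"
    unfolding cusp_det_def nd2 d.deriv3
    by (simp add: det_2 power2_eq_square algebra_simps)
  have three: "three_half_cusp d"
    unfolding three_half_cusp_def cusp nd1 using D m0 by simp
  have "scaled_sing_curv f \<nu> I \<gamma> = (\<lambda>t. sqrt \<bar>t\<bar> * (\<lambda>u. \<bar>det (vector [nth_deriv 1 c u, nth_deriv 2 c u,
      \<nu> (\<gamma> u)] :: real^3^3)\<bar> / norm (nth_deriv 1 c u) ^ 3) (the_inv_into I (arclength c) t))"
    by (intro ext) (simp only: scaled_sing_curv_def abs_sing_curv_def c_def)
  then have tends: "(scaled_sing_curv f \<nu> I \<gamma> \<longlongrightarrow>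
    sqrt (\<bar>m' 0\<bar> * norm (w 0) / 2) / \<bar>m' 0\<bar> * (\<bar>?D\<bar> / norm (w 0) ^ 3)) (at 0)"
    using tendsto_scaled_sing_curv[OF I[folded c_def] lim] abs_det_coords[OF tangent] by simp
  have "limiting_sing_curv f \<nu> I \<gamma> =
      2 * sqrt 2 * (sqrt (\<bar>m' 0\<bar> * norm (w 0) / 2) / \<bar>m' 0\<bar> * (\<bar>?D\<bar> / norm (w 0) ^ 3))"
    unfolding limiting_sing_curv_def using tendsto_Lim[OF _ tends] by simp
  also have "\<dots> = (2 * \<bar>m' 0\<bar>\<^sup>2 * \<bar>?D\<bar>) / (\<bar>m' 0\<bar> * norm (w 0)) powr (5/2)"
    using m0 w0 by (intro sqrt_powr_identity) auto
  also have "\<dots> = \<bar>cuspidal_curv d\<bar>"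
    unfolding cuspidal_curv_def cusp nd2
    by (simp add: abs_mult norm_coords[OF tangent(1)])
  finally show ?thesis
    using three tends unfolding d_def by blast
qed

end

section \<open>Charts and the standard swallowtail\<close>

text \<open>By the chain rule for \<open>g (f y) = y\<close>, the derivative of \<open>g\<close> is
  a left inverse of that of \<open>f\<close>.\<close>

lemma inj_frechet_derivative_of_left_inverse:
  assumes "open S" "x \<in> S" "f differentiable at x" "g differentiable at (f x)"
    and inv: "\<And>y. y \<in> S \<Longrightarrow> g (f y) = y"
  shows "inj (frechet_derivative f (at x))"
proof (rule inj_on_inverseI)
  have "((\<lambda>y. g (f y)) has_derivative
      (\<lambda>v. frechet_derivative g (at (f x)) (frechet_derivative f (at x) v))) (at x)"
    by (rule has_derivative_compose) (use assms(3,4) frechet_derivative_works in blast)+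
  moreover have "((\<lambda>y. g (f y)) has_derivative (\<lambda>v. v)) (at x)"
    by (rule has_derivative_transform_within_open[OF has_derivative_ident assms(1,2)]) (simp add: inv)
  ultimately show "frechet_derivative g (at (f x)) (frechet_derivative f (at x) v) = v" for v
    by (metis has_derivative_unique)
qed

lemma diffeo_on_inj_derivative:
  assumes "diffeo_on E \<Psi>" "x \<in> E"
  shows "inj (frechet_derivative \<Psi> (at x))"
proof (rule inj_frechet_derivative_of_left_inverse)
  show "\<Psi> differentiable at x" "inv_into E \<Psi> differentiable at (\<Psi> x)"
    using assms by (auto simp: diffeo_on_def intro!: differentiableI smooth_on_imp_has_derivative)
qed (use assms in \<open>auto simp: diffeo_on_def inv_into_f_f\<close>)

section \<open>The standard swallowtail and its differential\<close>

lemma smooth_on_vec_nth: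
  "open S \<Longrightarrow> smooth_on S f \<Longrightarrow> smooth_on S (\<lambda>x. f x $ i)"
  for f :: "'a::euclidean_space \<Rightarrow> real^'n"
  using smooth_on_compose[of S f UNIV "\<lambda>x. x $ i"]
  by (auto intro: smooth_on_bounded_linear bounded_linear_vec_nth)

text \<open>Written as a sum along the axes, a vector becomes accessible to the rules for sums and
  scalings.\<close>

lemma vector_3_axis:
  "(vector [a, b, c] :: real^3) = a *\<^sub>R axis 1 1 + b *\<^sub>R axis 2 1 + c *\<^sub>R axis 3 1"
  by (simp add: vec_eq_iff forall_3 axis_def)

lemma smooth_on_vector_3:
  assumes "open S" "smooth_on S a" "smooth_on S b" "smooth_on S c"
  shows "smooth_on S (\<lambda>x. vector [a x, b x, c x] :: real^3)"
  unfolding vector_3_axis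
  by (intro smooth_on_add smooth_on_scaleR smooth_on_const assms)

lemma smooth_on_power: "open S \<Longrightarrow> smooth_on S f \<Longrightarrow> smooth_on S (\<lambda>x. f x ^ n :: real)"
  by (induction n) (auto intro: smooth_on_const smooth_on_mult)

lemma smooth_on_std_swallowtail: "smooth_on UNIV std_swallowtail"
  unfolding std_swallowtail_def Let_def
  by (intro smooth_on_vector_3 smooth_on_add smooth_on_mult smooth_on_power smooth_on_const
      smooth_on_vec_nth smooth_on_bounded_linear bounded_linear_ident open_UNIV)

text \<open>The Jacobian with the common factor \<open>12 v\<^sup>2 + 2 u\<close> of the second
  column pulled out. This factor vanishes exactly on the singular set, and the remaining column
  \<open>(0, 1, v)\<close> still spans the limiting tangent plane together with the first
  one.\<close>

definition std_swallowtail_diff :: "real^2 \<Rightarrow> real^2 \<Rightarrow> real^3" where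
  "std_swallowtail_diff x z = (z $ 1) *\<^sub>R vector [1, 2 * x $ 2, (x $ 2)\<^sup>2] +
    ((12 * (x $ 2)\<^sup>2 + 2 * x $ 1) * z $ 2) *\<^sub>R vector [0, 1, x $ 2]"

lemma std_swallowtail_has_derivative:
  "(std_swallowtail has_derivative std_swallowtail_diff x) (at x)"
  unfolding std_swallowtail_def Let_def vector_3_axis
  by (rule derivative_eq_intros bounded_linear_vec_nth[THEN bounded_linear_imp_has_derivative] refl)+
    (simp add: fun_eq_iff std_swallowtail_diff_def vec_eq_iff forall_3 axis_def algebra_simps
      power2_eq_square power3_eq_cube)

lemma inj_std_swallowtail_diff:
  assumes "12 * (x $ 2)\<^sup>2 + 2 * x $ 1 \<noteq> 0"
  shows "inj (std_swallowtail_diff x)"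
proof (rule injI)
  fix z z' assume eq: "std_swallowtail_diff x z = std_swallowtail_diff x z'"
  have 1: "z $ 1 = z' $ 1"
    using arg_cong[OF eq, of "\<lambda>y. y $ 1"] by (simp add: std_swallowtail_diff_def)
  have "z $ 2 = z' $ 2"
    using arg_cong[OF eq, of "\<lambda>y. y $ 2"] assms by (simp add: std_swallowtail_diff_def 1)
  with 1 show "z = z'" by (simp add: vec_eq_iff forall_2)
qed

section \<open>Maps and curves read in charts\<close>

lemma oriented_atlasD:
  assumes "oriented_atlas A" "(U, \<phi>) \<in> A"
  shows "open U" "open (\<phi> ` U)" "inj_on \<phi> U" "continuous_on U \<phi>"
    "V \<subseteq> U \<Longrightarrow> open V \<Longrightarrow> open (\<phi> ` V)"
proof -
  show U: "open U" and \<phi>U: "open (\<phi> ` U)"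
    using assms by (auto simp: oriented_atlas_def)
  have h: "homeomorphism U (\<phi> ` U) \<phi> (inv_into U \<phi>)"
    using assms by (auto simp: oriented_atlas_def)
  then show "inj_on \<phi> U" by (metis homeomorphism_apply1 inj_on_inverseI)
  show "continuous_on U \<phi>" by (rule homeomorphism_cont1[OF h])
  show "open (\<phi> ` V)" if "V \<subseteq> U" "open V"
    using homeomorphism_imp_open_map[OF h, of V] that U \<phi>U
    by (simp add: openin_open_eq)
qed

lemma oriented_atlas_cover:
  assumes "oriented_atlas A"
  obtains U \<phi> where "(U, \<phi>) \<in> A" "a \<in> U"
proof -
  have "a \<in> (\<Union>(U, \<phi>)\<in>A. U)" using assms by (simp add: oriented_atlas_def)
  then show thesis using that by auto
qed

lemma smooth_map_onD:
  assumes "smooth_map_on A W g"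
  shows "open W" "(U, \<phi>) \<in> A \<Longrightarrow> smooth_on (\<phi> ` (U \<inter> W)) (g \<circ> inv_into U \<phi>)"
  using assms unfolding smooth_map_on_def by blast+

lemma regular_curveD:
  assumes "regular_curve A I \<gamma>"
  shows "open I" "is_interval I" "continuous_on I \<gamma>"
    "(U, \<phi>) \<in> A \<Longrightarrow> smooth_on (I \<inter> \<gamma> -` U) (\<phi> \<circ> \<gamma>)"
    "(U, \<phi>) \<in> A \<Longrightarrow> u \<in> I \<inter> \<gamma> -` U \<Longrightarrow> vector_derivative (\<phi> \<circ> \<gamma>) (at u) \<noteq> 0"
  using assms unfolding regular_curve_def by blast+

lemma smooth_map_on_continuous_on:
  assumes A: "oriented_atlas A" and g: "smooth_map_on A W g"
  shows "continuous_on W g"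
proof (intro continuous_at_imp_continuous_on ballI)
  fix a assume a: "a \<in> W"
  obtain U \<phi> where U: "(U, \<phi>) \<in> A" "a \<in> U" using oriented_atlas_cover[OF A] .
  note \<phi> = oriented_atlasD[OF A U(1)]
  have "continuous_on (\<phi> ` (U \<inter> W)) (g \<circ> inv_into U \<phi>)"
    by (rule smooth_on_imp_continuous_on[OF smooth_map_onD(2)[OF g U(1)]])
  then have "continuous_on (U \<inter> W) (\<lambda>x. (g \<circ> inv_into U \<phi>) (\<phi> x))"
    by (rule continuous_on_compose2) (auto intro: continuous_on_subset[OF \<phi>(4)])
  then have "continuous_on (U \<inter> W) g"
    by (rule continuous_on_eq) (use \<phi>(3) in simp)
  moreover have "open (U \<inter> W)" using \<phi>(1) smooth_map_onD(1)[OF g] by auto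
  ultimately show "isCont g a"
    using a U by (auto simp: continuous_on_eq_continuous_at)
qed

text \<open>Both the curve and the map are smooth only through charts; composing their expressions
  in one chart cancels it.\<close>

lemma smooth_on_chart_curve:
  assumes A: "oriented_atlas A" and U: "(U, \<phi>) \<in> A" and \<gamma>: "regular_curve A I \<gamma>"
    and g: "smooth_map_on A W g"
  shows "open (I \<inter> \<gamma> -` (U \<inter> W))" "smooth_on (I \<inter> \<gamma> -` (U \<inter> W)) (\<lambda>u. g (\<gamma> u))"
proof -
  note \<phi> = oriented_atlasD[OF A U(1)]
  show J: "open (I \<inter> \<gamma> -` (U \<inter> W))"
    using regular_curveD[OF \<gamma>] \<phi>(1) smooth_map_onD(1)[OF g]
    by (intro continuous_open_preimage) auto
  have "smooth_on (I \<inter> \<gamma> -` (U \<inter> W)) (\<lambda>u. (g \<circ> inv_into U \<phi>) ((\<phi> \<circ> \<gamma>) u))"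
  proof (rule smooth_on_compose[where T = "\<phi> ` (U \<inter> W)", OF J])
    show "smooth_on (I \<inter> \<gamma> -` (U \<inter> W)) (\<phi> \<circ> \<gamma>)"
      by (rule smooth_on_subset[OF regular_curveD(4)[OF \<gamma> U]]) auto
    show "smooth_on (\<phi> ` (U \<inter> W)) (g \<circ> inv_into U \<phi>)"
      by (rule smooth_map_onD(2)[OF g U])
  qed auto
  then show "smooth_on (I \<inter> \<gamma> -` (U \<inter> W)) (\<lambda>u. g (\<gamma> u))"
    by (rule smooth_on_cong[OF J]) (use \<phi>(3) in simp)
qed

text \<open>The preimages of the charts cover \<open>I\<close>. Smoothness on all of
  \<open>I\<close> is the aim because the arclength integral ranges over it.\<close>

lemma smooth_on_regular_curve:
  assumes A: "oriented_atlas A" and \<gamma>: "regular_curve A I \<gamma>" and g: "smooth_map_on A UNIV g"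
  shows "smooth_on I (\<lambda>u. g (\<gamma> u))"
proof -
  have "smooth_on (\<Union>c\<in>A. I \<inter> \<gamma> -` (fst c \<inter> UNIV)) (\<lambda>u. g (\<gamma> u))"
    by (rule smooth_on_UN) (use smooth_on_chart_curve[OF A _ \<gamma> g] in auto)
  moreover have "(\<Union>c\<in>A. I \<inter> \<gamma> -` (fst c \<inter> UNIV)) = I"
  proof (intro equalityI subsetI)
    fix u assume "u \<in> I"
    moreover obtain U \<phi> where "(U, \<phi>) \<in> A" "\<gamma> u \<in> U" using oriented_atlas_cover[OF A] .
    ultimately show "u \<in> (\<Union>c\<in>A. I \<inter> \<gamma> -` (fst c \<inter> UNIV))" by force
  qed auto
  ultimately show ?thesis by simp
qed

section \<open>Singular points and the tangential plane in swallowtail coordinates\<close>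

locale swallowtail_coords =
  fixes A :: "'a::{t2_space,second_countable_topology} atlas" and f :: "'a \<Rightarrow> real^3" and p :: 'a
    and W k E \<Psi>
  assumes atlas: "oriented_atlas A" and p: "p \<in> W" and k: "smooth_coords_on A W k" "k p = 0"
    and \<Psi>: "0 \<in> E" "diffeo_on E \<Psi>"
    and factor: "\<And>a. a \<in> W \<Longrightarrow> std_swallowtail (k a) \<in> E \<and> f a = \<Psi> (std_swallowtail (k a))"
begin

abbreviation D\<Psi> :: "real^3 \<Rightarrow> real^3 \<Rightarrow> real^3" where
  "D\<Psi> x v \<equiv> frechet_derivative \<Psi> (at x) v"

lemma std_swallowtail_0: "std_swallowtail 0 = 0"
  by (simp add: std_swallowtail_def vec_eq_iff forall_3)

lemma coordsD:
  shows "open W" "open (k ` W)" "inj_on k W" "continuous_on (k ` W) (inv_into W k)"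
    "smooth_map_on A W k"
    "(U, \<phi>) \<in> A \<Longrightarrow> smooth_on (k ` (U \<inter> W)) (\<phi> \<circ> inv_into W k)"
proof -
  have h: "homeomorphism W (k ` W) k (inv_into W k)"
    using k unfolding smooth_coords_on_def by blast
  then show "inj_on k W" by (metis homeomorphism_apply1 inj_on_inverseI)
  show "continuous_on (k ` W) (inv_into W k)" by (rule homeomorphism_cont2[OF h])
  show "open (k ` W)" "smooth_map_on A W k"
    "(U, \<phi>) \<in> A \<Longrightarrow> smooth_on (k ` (U \<inter> W)) (\<phi> \<circ> inv_into W k)"
    using k unfolding smooth_coords_on_def by blast+
  from this(2) show "open W" by (rule smooth_map_onD)
qed

lemma smooth_\<Psi>: "open E" "smooth_on E \<Psi>"
  using \<Psi> by (auto simp: diffeo_on_def)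

lemma \<Psi>_has_derivative: "x \<in> E \<Longrightarrow> (\<Psi> has_derivative D\<Psi> x) (at x)"
  by (rule smooth_on_imp_has_derivative[OF smooth_\<Psi>(2)])

lemma linear_D\<Psi>: "x \<in> E \<Longrightarrow> linear (D\<Psi> x)"
  by (rule has_derivative_linear[OF \<Psi>_has_derivative])

lemma smooth_D\<Psi>: "smooth_on E (\<lambda>x. D\<Psi> x v)"
  by (rule smooth_on_frechet_derivative[OF smooth_\<Psi>(2)])

text \<open>Injectivity holds because \<open>\<phi> \<circ> inv_into W k\<close> is a differentiable
  local left inverse of \<open>k \<circ> inv_into U \<phi>\<close>.\<close>

lemma coords_derivative:
  assumes U: "(U, \<phi>) \<in> A" and a: "a \<in> U" "a \<in> W"
  shows "((k \<circ> inv_into U \<phi>) has_derivative frechet_derivative (k \<circ> inv_into U \<phi>) (at (\<phi> a))) (at (\<phi> a))"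
    and "inj (frechet_derivative (k \<circ> inv_into U \<phi>) (at (\<phi> a)))"
proof -
  note \<phi> = oriented_atlasD[OF atlas U]
  have inU: "\<phi> a \<in> \<phi> ` (U \<inter> W)" using a by auto
  have op: "open (\<phi> ` (U \<inter> W))" using \<phi>(5)[of "U \<inter> W"] \<phi>(1) coordsD(1) by auto
  show der: "((k \<circ> inv_into U \<phi>) has_derivative
      frechet_derivative (k \<circ> inv_into U \<phi>) (at (\<phi> a))) (at (\<phi> a))"
    by (rule smooth_on_imp_has_derivative[OF smooth_map_onD(2)[OF coordsD(5) U] inU])
  have ka: "(k \<circ> inv_into U \<phi>) (\<phi> a) = k a" using \<phi>(3) a by simp
  have "((\<phi> \<circ> inv_into W k) has_derivative
      frechet_derivative (\<phi> \<circ> inv_into W k) (at (k a))) (at (k a))"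
    by (rule smooth_on_imp_has_derivative[OF coordsD(6)[OF U]]) (use a in auto)
  then have "\<phi> \<circ> inv_into W k differentiable at ((k \<circ> inv_into U \<phi>) (\<phi> a))"
    unfolding ka by (rule differentiableI)
  moreover have "(\<phi> \<circ> inv_into W k) ((k \<circ> inv_into U \<phi>) x) = x" if "x \<in> \<phi> ` (U \<inter> W)" for x
    using that \<phi>(3) coordsD(3) by auto
  ultimately show "inj (frechet_derivative (k \<circ> inv_into U \<phi>) (at (\<phi> a)))"
    by (rule inj_frechet_derivative_of_left_inverse[OF op inU differentiableI[OF der]])
qed

lemma chart_diff_factor:
  assumes U: "(U, \<phi>) \<in> A" and a: "a \<in> U" "a \<in> W"
  shows "chart_diff (U, \<phi>) f a v = D\<Psi> (std_swallowtail (k a))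
    (std_swallowtail_diff (k a) (frechet_derivative (k \<circ> inv_into U \<phi>) (at (\<phi> a)) v))"
proof -
  note \<phi> = oriented_atlasD[OF atlas U]
  let ?h = "k \<circ> inv_into U \<phi>"
  have ka: "?h (\<phi> a) = k a" using \<phi>(3) a by simp
  have "((\<lambda>x. \<Psi> (std_swallowtail (?h x))) has_derivative
     (\<lambda>v. D\<Psi> (std_swallowtail (k a)) (std_swallowtail_diff (k a)
        (frechet_derivative ?h (at (\<phi> a)) v)))) (at (\<phi> a))"
    using has_derivative_compose[OF has_derivative_compose[OF coords_derivative(1)[OF assms]
        std_swallowtail_has_derivative] \<Psi>_has_derivative] factor[OF a(2)]
    by (simp only: ka)
  then have "((f \<circ> inv_into U \<phi>) has_derivative
     (\<lambda>v. D\<Psi> (std_swallowtail (k a)) (std_swallowtail_diff (k a)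
        (frechet_derivative ?h (at (\<phi> a)) v)))) (at (\<phi> a))"
  proof (rule has_derivative_transform_within_open)
    show "open (\<phi> ` (U \<inter> W))" using \<phi>(5)[of "U \<inter> W"] \<phi>(1) coordsD(1) by auto
    show "\<Psi> (std_swallowtail (?h x)) = (f \<circ> inv_into U \<phi>) x" if "x \<in> \<phi> ` (U \<inter> W)" for x
      using that factor \<phi>(3) by auto
  qed (use a in auto)
  from frechet_derivative_at[OF this] show ?thesis
    by (simp add: chart_diff_def fun_eq_iff)
qed

text \<open>Where \<open>12 v\<^sup>2 + 2 u\<close> is nonzero, all three factors of the
  differential in \<open>chart_diff_factor\<close> are injective, so the point is not
  singular.\<close>

lemma singular_pt_coords:
  assumes "a \<in> W" "singular_pt A f a"
  shows "k a $ 1 = - 6 * (k a $ 2)\<^sup>2"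
proof (rule ccontr)
  assume "k a $ 1 \<noteq> - 6 * (k a $ 2)\<^sup>2"
  then have ne: "12 * (k a $ 2)\<^sup>2 + 2 * k a $ 1 \<noteq> 0" by linarith
  obtain U \<phi> where U: "(U, \<phi>) \<in> A" "a \<in> U" and not_inj: "\<not> inj (chart_diff (U, \<phi>) f a)"
    using assms(2) by (auto simp: singular_pt_def immersive_at_def)
  let ?s = "std_swallowtail (k a)" and ?H = "frechet_derivative (k \<circ> inv_into U \<phi>) (at (\<phi> a))"
  have "inj (D\<Psi> ?s \<circ> std_swallowtail_diff (k a) \<circ> ?H)"
    using factor[OF assms(1)]
    by (intro inj_compose diffeo_on_inj_derivative[OF \<Psi>(2)] inj_std_swallowtail_diff ne
        coords_derivative(2) U assms(1)) auto
  moreover have "chart_diff (U, \<phi>) f a = D\<Psi> ?s \<circ> std_swallowtail_diff (k a) \<circ> ?H"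
    using chart_diff_factor[OF U assms(1)] by (simp add: fun_eq_iff)
  ultimately show False using not_inj by simp
qed

text \<open>The derivative of the coordinate change is an injective linear map of the plane, hence
  onto, so orthogonality in a chart passes to every direction \<open>z\<close> of the swallowtail
  coordinates.\<close>

lemma normal_orthogonal:
  assumes "unit_normal_on A f N \<nu>" "a \<in> N" "a \<in> W"
  shows "\<nu> a \<bullet> D\<Psi> (std_swallowtail (k a)) (std_swallowtail_diff (k a) z) = 0"
proof -
  obtain U \<phi> where U: "(U, \<phi>) \<in> A" "a \<in> U" using oriented_atlas_cover[OF atlas] .
  let ?H = "frechet_derivative (k \<circ> inv_into U \<phi>) (at (\<phi> a))"
  have "surj ?H"
    using coords_derivative[OF U assms(3)]
    by (intro linear_injective_imp_surjective) (auto intro: has_derivative_linear)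
  then obtain v where "z = ?H v" by (metis surjD)
  moreover have "\<nu> a \<bullet> chart_diff (U, \<phi>) f a v = 0"
    using assms(1,2) U unfolding unit_normal_on_def by fastforce
  ultimately show ?thesis
    by (simp add: chart_diff_factor[OF U assms(3)])
qed

text \<open>Since \<open>df\<close> has rank one at \<open>p\<close>, the second direction of the tangential plane is found
  as the limit of the tangent planes along the coordinate line \<open>u = 0\<close>.\<close>

lemma normal_orthogonal_tangent_plane:
  assumes \<nu>: "unit_normal_on A f N \<nu>" and "p \<in> N"
  shows "\<nu> p \<bullet> D\<Psi> 0 (axis 1 1) = 0" "\<nu> p \<bullet> D\<Psi> 0 (axis 2 1) = 0"
proof -
  have axis: "vector [1, 0, 0] = (axis 1 1 :: real^3)" "vector [0, 1, 0] = (axis 2 1 :: real^3)"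
    by (simp_all add: vector_3_axis)
  show "\<nu> p \<bullet> D\<Psi> 0 (axis 1 1) = 0"
    using normal_orthogonal[OF assms p, of "axis 1 1"]
    by (simp add: k std_swallowtail_0 std_swallowtail_diff_def axis axis_def[of 1])
  have sm: "smooth_map_on A N \<nu>" using \<nu> by (simp add: unit_normal_on_def)
  then have N: "open N" and cont\<nu>: "continuous_on N \<nu>"
    using smooth_map_on_continuous_on[OF atlas] smooth_map_onD by blast+
  define l where "l v = (vector [0, v] :: real^2)" for v
  define b where "b v = inv_into W k (l v)" for v
  have l: "(l \<longlongrightarrow> 0) (at 0)"
  proof (rule vec_tendstoI)
    have "((\<lambda>v::real. v) \<longlongrightarrow> 0) (at 0)" by (rule tendsto_ident_at)
    then show "((\<lambda>v. l v $ i) \<longlongrightarrow> 0 $ i) (at 0)" for i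
      using exhaust_2[of i] by (auto simp: l_def)
  qed
  have kp: "0 \<in> k ` W" "inv_into W k 0 = p"
    using p k(2) inv_into_f_f[OF coordsD(3) p] by force+
  have "isCont (inv_into W k) 0"
    using continuous_on_eq_continuous_at[OF coordsD(2)] coordsD(4) kp(1) by blast
  from isCont_tendsto_compose[OF this l] have b: "(b \<longlongrightarrow> p) (at 0)"
    by (simp add: b_def[abs_def] kp(2))
  have "isCont \<nu> p" using cont\<nu> N \<open>p \<in> N\<close> by (simp add: continuous_on_eq_continuous_at)
  then have \<nu>b: "((\<lambda>v. \<nu> (b v)) \<longlongrightarrow> \<nu> p) (at 0)" using b by (rule isCont_tendsto_compose)
  have "isCont std_swallowtail 0"
    using has_derivative_continuous[OF std_swallowtail_has_derivative] .
  then have s: "((\<lambda>v. std_swallowtail (l v)) \<longlongrightarrow> 0) (at 0)"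
    using isCont_tendsto_compose[OF _ l] by (metis std_swallowtail_0)
  have D: "((\<lambda>v. D\<Psi> (std_swallowtail (l v)) z) \<longlongrightarrow> D\<Psi> 0 z) (at 0)" for z
  proof (rule isCont_tendsto_compose[OF _ s])
    show "isCont (\<lambda>x. D\<Psi> x z) 0"
      using smooth_on_imp_continuous_on[OF smooth_D\<Psi>] smooth_\<Psi>(1) \<Psi>(1)
      by (simp add: continuous_on_eq_continuous_at)
  qed
  have "((\<lambda>v. \<nu> (b v) \<bullet> (D\<Psi> (std_swallowtail (l v)) (axis 2 1) +
      v *\<^sub>R D\<Psi> (std_swallowtail (l v)) (axis 3 1))) \<longlongrightarrow>
      \<nu> p \<bullet> (D\<Psi> 0 (axis 2 1) + 0 *\<^sub>R D\<Psi> 0 (axis 3 1))) (at 0)"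
    by (intro tendsto_intros \<nu>b D)
  moreover have "((\<lambda>v. \<nu> (b v) \<bullet> (D\<Psi> (std_swallowtail (l v)) (axis 2 1) +
      v *\<^sub>R D\<Psi> (std_swallowtail (l v)) (axis 3 1))) \<longlongrightarrow> 0) (at 0)"
  proof (rule Lim_transform_eventually[OF tendsto_const])
    have "\<forall>\<^sub>F v in at 0. b v \<in> N"
      using topological_tendstoD[OF b N \<open>p \<in> N\<close>] .
    moreover have "\<forall>\<^sub>F v in at 0. l v \<in> k ` W"
      using topological_tendstoD[OF l coordsD(2) kp(1)] .
    ultimately show "\<forall>\<^sub>F v in at 0. 0 = \<nu> (b v) \<bullet> (D\<Psi> (std_swallowtail (l v)) (axis 2 1) +
      v *\<^sub>R D\<Psi> (std_swallowtail (l v)) (axis 3 1))"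
      using eventually_neq_at_within[of 0 0 UNIV]
    proof eventually_elim
      case (elim v)
      have bW: "b v \<in> W" and kb: "k (b v) = l v"
        using elim(2) by (auto simp: b_def inv_into_into f_inv_into_f)
      have E: "std_swallowtail (l v) \<in> E" using factor[OF bW] by (simp add: kb)
      interpret linear "D\<Psi> (std_swallowtail (l v))" by (rule linear_D\<Psi>[OF E])
      \<comment> \<open>On the line \<open>u = 0\<close> the second column is
        \<open>12 v\<^sup>2\<close> times \<open>(0, 1, v)\<close>. For nonzero \<open>v\<close> the
        scalar is divided out before passing to the limit.\<close>
      have "std_swallowtail_diff (l v) (axis 2 1) = (12 * v\<^sup>2) *\<^sub>R (axis 2 1 + v *\<^sub>R axis 3 1)"
        by (simp add: std_swallowtail_diff_def l_def vector_3_axis axis_def[of "2::2"])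
      then have "(12 * v\<^sup>2) * (\<nu> (b v) \<bullet> (D\<Psi> (std_swallowtail (l v)) (axis 2 1) +
          v *\<^sub>R D\<Psi> (std_swallowtail (l v)) (axis 3 1))) = 0"
        using normal_orthogonal[OF \<nu> elim(1) bW, of "axis 2 1"] by (simp add: kb add scale)
      with elim(3) show ?case by simp
    qed
  qed
  ultimately have "\<nu> p \<bullet> (D\<Psi> 0 (axis 2 1) + 0 *\<^sub>R D\<Psi> 0 (axis 3 1)) = 0"
    by (rule tendsto_unique[OF at_neq_bot])
  then show "\<nu> p \<bullet> D\<Psi> 0 (axis 2 1) = 0" by simp
qed

end

section \<open>Velocity of the image of the singular curve\<close>

lemma has_vector_derivative_vector_3:
  assumes "(a has_real_derivative a') (at u)" "(b has_real_derivative b') (at u)"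
    "(c has_real_derivative c') (at u)"
  shows "((\<lambda>u. vector [a u, b u, c u] :: real^3) has_vector_derivative vector [a', b', c']) (at u)"
proof -
  have scale: "((\<lambda>u. r u *\<^sub>R x) has_vector_derivative r' *\<^sub>R x) (at u)"
    if "(r has_real_derivative r') (at u)" for r r' and x :: "real^3"
    using has_vector_derivative_scaleR[OF that has_vector_derivative_const[of x]] by simp
  show ?thesis
    unfolding vector_3_axis by (intro has_vector_derivative_add scale assms)
qed

context swallowtail_coords
begin

text \<open>Here \<open>w\<close> is the image under \<open>D\<Psi>\<close> of
  \<open>(1, 2 y, y\<^sup>2)\<close>, the first column of the model differential along the curve,
  and \<open>b\<close> is \<open>y' 0\<close>.\<close>

lemma singular_curve_velocity:
  assumes sing: "singular_curve A f p I \<gamma>"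
  obtains J w w' m m' m'' w'' b
  where "cuspidal_curve J (f \<circ> \<gamma>) w w' m m' m'' w''"
    and "w 0 = D\<Psi> 0 (axis 1 1)" and "w' 0 = (2 * b) *\<^sub>R D\<Psi> 0 (axis 2 1)" and "b \<noteq> 0"
proof -
  have reg: "regular_curve A I \<gamma>" and I0: "0 \<in> I" and \<gamma>0: "\<gamma> 0 = p"
    and singular: "\<And>u. u \<in> I \<Longrightarrow> singular_pt A f (\<gamma> u)"
    using sing unfolding singular_curve_def by blast+
  obtain U \<phi> where U: "(U, \<phi>) \<in> A" "p \<in> U" using oriented_atlas_cover[OF atlas] .
  note \<phi> = oriented_atlasD[OF atlas U(1)]
  define J where "J = I \<inter> \<gamma> -` (U \<inter> W)"
  define K where "K u = k (\<gamma> u)" for u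
  have J: "open J" and K: "smooth_on J K"
    using smooth_on_chart_curve[OF atlas U(1) reg coordsD(5)] by (simp_all add: J_def K_def[abs_def])
  have J0: "0 \<in> J" using I0 \<gamma>0 U(2) p by (simp add: J_def)
  define y where "y u = K u $ 2" for u
  have K1: "K u $ 1 = - 6 * (y u)\<^sup>2" if "u \<in> J" for u
    using singular_pt_coords[of "\<gamma> u"] singular that by (simp add: J_def K_def y_def)
  have y: "smooth_on J y"
    unfolding y_def using smooth_on_vec_nth[OF J K] .
  define y' where "y' u = vector_derivative y (at u)" for u
  have y': "smooth_on J y'" unfolding y'_def by (rule smooth_on_vector_derivative[OF J y])
  have dy: "(y has_real_derivative y' u) (at u)" if "u \<in> J" for u
    using smooth_on_imp_has_vector_derivative[OF y that]
    by (simp add: has_real_derivative_iff_has_vector_derivative y'_def)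
  have y0: "y 0 = 0" by (simp add: y_def K_def \<gamma>0 k)
  \<comment> \<open>If \<open>y' 0\<close> were zero, the first coordinate
    \<open>- 6 y\<^sup>2\<close> would be stationary as well. Injectivity of the coordinate change
    would then force the velocity of the regular curve to vanish at \<open>0\<close>.\<close>
  have y'0: "y' 0 \<noteq> 0"
  proof
    assume zero: "y' 0 = 0"
    let ?h = "k \<circ> inv_into U \<phi>" and ?V = "vector_derivative (\<phi> \<circ> \<gamma>) (at 0)"
    let ?H = "frechet_derivative ?h (at (\<phi> p))"
    have 0: "0 \<in> I \<inter> \<gamma> -` U" using I0 \<gamma>0 U(2) by simp
    have H: "(?h has_derivative ?H) (at (\<phi> p))" "inj ?H"
      using coords_derivative[OF U p] .
    interpret H: linear ?H by (rule has_derivative_linear[OF H(1)])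
    have V: "((\<phi> \<circ> \<gamma>) has_vector_derivative ?V) (at 0)"
      by (rule smooth_on_imp_has_vector_derivative[OF regular_curveD(4)[OF reg U(1)] 0])
    have "((\<lambda>u. ?h ((\<phi> \<circ> \<gamma>) u)) has_vector_derivative ?H ?V) (at 0)"
      using has_derivative_compose[OF V[unfolded has_vector_derivative_def], of ?h ?H] H(1)
      by (simp add: has_vector_derivative_def \<gamma>0 H.scale)
    then have "(K has_vector_derivative ?H ?V) (at 0)"
      by (rule has_vector_derivative_transform_within_open[OF _ J J0])
        (use \<phi>(3) in \<open>auto simp: J_def K_def\<close>)
    then have K': "((\<lambda>u. K u $ i) has_real_derivative ?H ?V $ i) (at 0)" for i
      using bounded_linear.has_vector_derivative[OF bounded_linear_vec_nth]
      by (auto simp: has_real_derivative_iff_has_vector_derivative)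
    have "?H ?V $ 2 = 0"
      using DERIV_unique[OF K'[of 2] dy[OF J0, unfolded y_def[abs_def]]] zero by simp
    moreover have "?H ?V $ 1 = 0"
    proof -
      have "((\<lambda>u. - 6 * (y u)\<^sup>2) has_real_derivative 0) (at 0)"
        using dy[OF J0] by (auto intro!: derivative_eq_intros simp: y0)
      then have "((\<lambda>u. K u $ 1) has_real_derivative 0) (at 0)"
        by (rule has_field_derivative_transform_within_open[OF _ J J0]) (simp add: K1)
      with K'[of 1] show ?thesis by (rule DERIV_unique)
    qed
    ultimately have "?H ?V = ?H 0" by (simp add: vec_eq_iff forall_2 H.zero)
    with H(2) have "?V = 0" by (rule injD)
    then show False using regular_curveD(5)[OF reg U(1) 0] by simp
  qed
  define g where "g u = std_swallowtail (K u)" for u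
  have g: "smooth_on J g"
    unfolding g_def by (rule smooth_on_compose[OF J K smooth_on_std_swallowtail]) simp
  have gE: "g u \<in> E" and fg: "f (\<gamma> u) = \<Psi> (g u)" if "u \<in> J" for u
    using that factor by (auto simp: g_def K_def J_def)
  have g0: "g 0 = 0" by (simp add: g_def K_def \<gamma>0 k std_swallowtail_0)
  define m where "m u = - 12 * y u * y' u" for u
  have m: "smooth_on J m"
    unfolding m_def by (intro smooth_on_mult smooth_on_const J y y')
  have dg: "(g has_vector_derivative m u *\<^sub>R vector [1, 2 * y u, (y u)\<^sup>2]) (at u)" if "u \<in> J" for u
  proof (rule has_vector_derivative_transform_within_open[OF _ J that])
    \<comment> \<open>Substituting \<open>u = - 6 v\<^sup>2\<close> into the model gives the
      coefficients \<open>4 - 12 = -8\<close> and \<open>3 - 6 = -3\<close>.\<close>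
    show "vector [- 6 * (y u)\<^sup>2, - 8 * (y u) ^ 3, - 3 * (y u) ^ 4] = g u" if "u \<in> J" for u
      using K1[OF that]
      by (simp add: g_def std_swallowtail_def y_def[symmetric] vec_eq_iff forall_3 Let_def eval_nat_numeral)
    have "((\<lambda>u. vector [- 6 * (y u)\<^sup>2, - 8 * (y u) ^ 3, - 3 * (y u) ^ 4] :: real^3)
      has_vector_derivative vector [- 6 * (2 * y u * y' u), - 8 * (3 * (y u)\<^sup>2 * y' u),
        - 3 * (4 * (y u) ^ 3 * y' u)]) (at u)"
      by (intro has_vector_derivative_vector_3)
        (use dy[OF that] in \<open>auto intro!: derivative_eq_intros\<close>)
    also have "vector [- 6 * (2 * y u * y' u), - 8 * (3 * (y u)\<^sup>2 * y' u),
        - 3 * (4 * (y u) ^ 3 * y' u)] = m u *\<^sub>R (vector [1, 2 * y u, (y u)\<^sup>2] :: real^3)"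
      by (simp add: vec_eq_iff forall_3 m_def power2_eq_square power3_eq_cube)
    finally show "((\<lambda>u. vector [- 6 * (y u)\<^sup>2, - 8 * (y u) ^ 3, - 3 * (y u) ^ 4] :: real^3)
      has_vector_derivative m u *\<^sub>R vector [1, 2 * y u, (y u)\<^sup>2]) (at u)" .
  qed
  define F where "F i u = D\<Psi> (g u) (axis i 1)" for i u
  define w where "w u = F 1 u + (2 * y u) *\<^sub>R F 2 u + ((y u)\<^sup>2) *\<^sub>R F 3 u" for u
  have F: "smooth_on J (F i)" for i
    unfolding F_def by (rule smooth_on_compose[OF J g smooth_D\<Psi>]) (use gE in auto)
  have w: "smooth_on J w"
    unfolding w_def
    by (intro smooth_on_add smooth_on_scaleR smooth_on_mult smooth_on_power smooth_on_const J y F)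
  \<comment> \<open>The curve \<open>g\<close> is stationary at \<open>0\<close>, so the columns of
    \<open>D\<Psi>\<close> along it are too. In \<open>w' 0\<close> only the derivative of the
    coefficient \<open>2 y\<close> survives.\<close>
  have dF: "(F i has_vector_derivative 0) (at 0)" for i
  proof -
    have "(g has_derivative (\<lambda>r. 0)) (at 0)"
      using dg[OF J0] by (simp add: has_vector_derivative_def m_def y0)
    moreover have "((\<lambda>x. D\<Psi> x (axis i 1)) has_derivative
        frechet_derivative (\<lambda>x. D\<Psi> x (axis i 1)) (at (g 0))) (at (g 0))"
      (is "(_ has_derivative ?G) _")
      by (rule smooth_on_imp_has_derivative[OF smooth_D\<Psi> gE[OF J0]])
    ultimately have "((\<lambda>u. D\<Psi> (g u) (axis i 1)) has_derivative (\<lambda>r. ?G 0)) (at 0)"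
      by (rule has_derivative_compose)
    moreover have "?G 0 = 0"
      by (rule linear_0[OF has_derivative_linear[OF smooth_on_imp_has_derivative[OF smooth_D\<Psi> gE[OF J0]]]])
    ultimately show ?thesis by (simp add: has_vector_derivative_def F_def[abs_def])
  qed
  have "(w has_vector_derivative 0 + ((2 * y 0) *\<^sub>R 0 + (2 * y' 0) *\<^sub>R F 2 0) +
      (((y 0)\<^sup>2) *\<^sub>R 0 + (2 * y 0 * y' 0) *\<^sub>R F 3 0)) (at 0)"
    unfolding w_def
    by (intro has_vector_derivative_add has_vector_derivative_scaleR dF)
      (use dy[OF J0] in \<open>auto intro!: derivative_eq_intros\<close>)
  then have "(w has_vector_derivative (2 * y' 0) *\<^sub>R D\<Psi> 0 (axis 2 1)) (at 0)"
    by (simp add: y0 F_def g0)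
  then have w'0: "vector_derivative w (at 0) = (2 * y' 0) *\<^sub>R D\<Psi> 0 (axis 2 1)"
    by (rule vector_derivative_at)
  have w0: "w 0 = D\<Psi> 0 (axis 1 1)" by (simp add: w_def y0 F_def g0)
  define y'' where "y'' = vector_derivative y' (at 0)"
  have dy': "(y' has_real_derivative y'') (at 0)"
    using smooth_on_imp_has_vector_derivative[OF y' J0]
    by (simp add: has_real_derivative_iff_has_vector_derivative y''_def)
  \<comment> \<open>Since \<open>y 0 = 0\<close>, the term with \<open>y''\<close> vanishes; what is
    left is nonzero because \<open>y' 0\<close> is.\<close>
  have "(m has_real_derivative - 12 * (y' 0)\<^sup>2) (at 0)"
    unfolding m_def
    using dy[OF J0] dy' by (auto intro!: derivative_eq_intros simp: y0 power2_eq_square)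
  then have m'0: "vector_derivative m (at 0) = - 12 * (y' 0)\<^sup>2"
    by (intro vector_derivative_at) (simp add: has_real_derivative_iff_has_vector_derivative)
  note sm' = smooth_on_vector_derivative[OF J m] and sw' = smooth_on_vector_derivative[OF J w]
  have "cuspidal_curve J (f \<circ> \<gamma>) w (\<lambda>u. vector_derivative w (at u)) m
    (\<lambda>u. vector_derivative m (at u)) (vector_derivative (\<lambda>u. vector_derivative m (at u)) (at 0))
    (vector_derivative (\<lambda>u. vector_derivative w (at u)) (at 0))"
  proof
    show "(f \<circ> \<gamma> has_vector_derivative m u *\<^sub>R w u) (at u)" if u: "u \<in> J" for u
    proof (rule has_vector_derivative_transform_within_open[OF _ J u])
      interpret linear "D\<Psi> (g u)" by (rule linear_D\<Psi>[OF gE[OF u]])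
      have "D\<Psi> (g u) (r *\<^sub>R m u *\<^sub>R vector [1, 2 * y u, (y u)\<^sup>2]) = r *\<^sub>R m u *\<^sub>R w u" for r
        by (simp add: vector_3_axis add scale w_def F_def)
      then show "((\<lambda>u. \<Psi> (g u)) has_vector_derivative m u *\<^sub>R w u) (at u)"
        using has_derivative_compose[OF dg[OF u, unfolded has_vector_derivative_def]
            \<Psi>_has_derivative[OF gE[OF u]]]
        by (simp add: has_vector_derivative_def)
    qed (simp add: fg)
    show "w 0 \<noteq> 0"
    proof
      assume "w 0 = 0"
      then have "D\<Psi> 0 (axis 1 1) = D\<Psi> 0 0" by (simp add: w0 linear_0[OF linear_D\<Psi>[OF \<Psi>(1)]])
      with diffeo_on_inj_derivative[OF \<Psi>(2,1)] have "axis 1 1 = (0 :: real^3)" by (rule injD)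
      then show False by (simp add: axis_eq_0_iff)
    qed
    show "m 0 = 0" "vector_derivative m (at 0) \<noteq> 0"
      using y'0 by (simp_all add: m_def y0 m'0)
  qed (use J J0 smooth_on_imp_has_vector_derivative[OF m] smooth_on_imp_has_vector_derivative[OF w]
      smooth_on_imp_has_vector_derivative[OF sm'] smooth_on_imp_has_vector_derivative[OF sw']
      in \<open>simp_all add: has_real_derivative_iff_has_vector_derivative\<close>)
  then show thesis using w0 w'0 y'0 by (rule that)
qed

end

theorem corollary3p10:
  fixes A :: "'a::{t2_space,second_countable_topology} atlas"
    and f \<nu> :: "'a \<Rightarrow> real^3" and p :: 'a and N :: "'a set"
    and I :: "real set" and \<gamma> :: "real \<Rightarrow> 'a"
    and P :: "(real^3) set" and \<sigma> :: "real \<Rightarrow> real^3" and q e1 e2 :: "real^3"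
  assumes "oriented_atlas A"
    and "front A f"
    and "swallowtail A f p"
    and "p \<in> N" and "unit_normal_on A f N \<nu>"
    and "singular_curve A f p I \<gamma>"
    and "P = tangential_plane f \<nu> p"
    and "\<sigma> = orth_proj P \<circ> (f \<circ> \<gamma>)"
    and "plane_frame P q e1 e2"
  shows "three_half_cusp (plane_coords q e1 e2 \<circ> \<sigma>) \<and>
    (\<exists>l. (scaled_sing_curv f \<nu> I \<gamma> \<longlongrightarrow> l) (at 0)) \<and>
    limiting_sing_curv f \<nu> I \<gamma> = \<bar>cuspidal_curv (plane_coords q e1 e2 \<circ> \<sigma>)\<bar>"
proof -
  obtain W k E \<Psi> where "p \<in> W" "smooth_coords_on A W k" "k p = 0" "0 \<in> E" "diffeo_on E \<Psi>"
    "\<forall>a\<in>W. std_swallowtail (k a) \<in> E \<and> f a = \<Psi> (std_swallowtail (k a))"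
    using assms(3) unfolding swallowtail_def by blast
  then interpret swallowtail_coords A f p W k E \<Psi>
    using assms(1) by unfold_locales auto
  obtain J w w' m m' m'' w'' b
    where curve: "cuspidal_curve J (f \<circ> \<gamma>) w w' m m' m'' w''"
    and w_at_0: "w 0 = D\<Psi> 0 (axis 1 1)" and w'_at_0: "w' 0 = (2 * b) *\<^sub>R D\<Psi> 0 (axis 2 1)" and b: "b \<noteq> 0"
    using singular_curve_velocity[OF assms(6)] by blast
  interpret cuspidal_space_curve J "f \<circ> \<gamma>" w w' m m' m'' w''
    by (rule cuspidal_space_curve.intro[OF curve])
  have reg: "regular_curve A I \<gamma>" and I0: "0 \<in> I" and \<gamma>0: "\<gamma> 0 = p"
    using assms(6) by (auto simp: singular_curve_def)
  note I = regular_curveD(1-3)[OF reg]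
  have "smooth_on I (\<lambda>u. f (\<gamma> u))"
    by (rule smooth_on_regular_curve[OF assms(1) reg]) (use assms(2) in \<open>simp add: front_def\<close>)
  then have cont: "continuous_on I (nth_deriv 1 (f \<circ> \<gamma>))"
    using smooth_on_imp_continuous_on[OF smooth_on_vector_derivative[OF I(1)]]
    by (simp add: nth_deriv_def comp_def)
  have N: "open N" "continuous_on N \<nu>" and norm_p: "norm (\<nu> p) = 1"
    using assms(4,5) smooth_map_onD(1) smooth_map_on_continuous_on[OF assms(1)]
    unfolding unit_normal_on_def by blast+
  have "isCont \<nu> (\<gamma> 0)" "isCont \<gamma> 0"
    using N I(1,3) I0 \<gamma>0 assms(4) continuous_on_eq_continuous_at by blast+
  then have "((\<lambda>u. \<nu> (\<gamma> u)) \<longlongrightarrow> \<nu> (\<gamma> 0)) (at 0)"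
    by (simp add: isCont_def isCont_tendsto_compose)
  then have lim: "((\<lambda>u. \<nu> (\<gamma> u)) \<longlongrightarrow> \<nu> p) (at 0)" by (simp add: \<gamma>0)
  \<comment> \<open>Membership of \<open>q\<close>, \<open>q + e1\<close> and \<open>q + e2\<close>
    in the plane gives, by subtraction, that \<open>e1\<close> and \<open>e2\<close> are orthogonal
    to the normal.\<close>
  have frame: "orthonormal_frame (\<nu> p) e1 e2"
    using assms(9) norm_p
    by unfold_locales (auto simp: plane_frame_def assms(7) tangential_plane_def
        inner_add_left inner_diff_left)
  have tangent: "w 0 \<bullet> \<nu> p = 0" "w' 0 \<bullet> \<nu> p = 0"
    using normal_orthogonal_tangent_plane[OF assms(5,4)]
    by (simp_all add: w_at_0 w'_at_0 inner_commute)
  \<comment> \<open>The derivative of the diffeomorphism \<open>\<Psi>\<close> at \<open>0\<close>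
    is injective, so it keeps the first two axes independent, and \<open>b \<noteq> 0\<close>
    prevents \<open>w' 0\<close> from degenerating.\<close>
  have indep: "r = 0 \<and> s = 0" if "r *\<^sub>R w 0 + s *\<^sub>R w' 0 = 0" for r s
  proof -
    interpret linear "D\<Psi> 0" by (rule linear_D\<Psi>[OF \<Psi>(1)])
    have "D\<Psi> 0 (r *\<^sub>R axis 1 1 + (s * (2 * b)) *\<^sub>R axis 2 1) = D\<Psi> 0 0"
      using that by (simp add: w_at_0 w'_at_0 add scale zero)
    with diffeo_on_inj_derivative[OF \<Psi>(2,1)]
    have "r *\<^sub>R axis 1 1 + (s * (2 * b)) *\<^sub>R axis 2 1 = (0 :: real^3)"
      by (rule injD)
    then show ?thesis using b by (simp add: vec_eq_iff forall_3 axis_def)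
  qed
  have proj: "\<exists>r. \<sigma> u = (f \<circ> \<gamma>) u - r *\<^sub>R \<nu> p" for u
    by (auto simp: assms(7,8) orth_proj_tangential_plane[where \<nu> = \<nu> and p = p, OF norm_p])
  show ?thesis
    by (rule limiting_curvature_eq_cuspidal_curvature
        [OF I(1,2) I0 cont refl lim frame tangent indep proj])
qed

end
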